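(* Let $(\lambda_1,\dots,\lambda_v)$ and $(\mu_1,\dots,\mu_m)$ be positive real numbers with $$\mathrm{span}_{\mathbb{Q}_0^+}\{\lambda_j\}_{j=1}^v\cap\mathrm{span}_{\mathbb{Q}_0^+}\{\mu_l\}_{l=1}^m=\{0\}.$$ Let $B$ be a small ball centered at $0\in\mathbb{C}^n$ and let $F_l:B\to\mathbb{C}^{N_l}$, $G_j:B\to\mathbb{C}^{N'_j}$ be non-constant holomorphic maps with $F_l(0)=0$, $G_j(0)=0$, satisfying $$\prod_{l=1}^m\big(1+F_l(z)\cdot\bar F_l(\xi)\big)^{\mu_l}\prod_{j=1}^v\big(1+G_j(z)\cdot\bar G_j(\xi)\big)^{-\lambda_j}=\phi(z,\xi)\quad\text{on }B\times B,$$ where $\phi(z,\xi)$ is holomorphic and algebraic on $B\times B$. Then every $F_l$ and every $G_j$ is Nash algebraic.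
   Context: $\mathbb{Q}_0^+$ is the set of nonnegative rationals; $\mathrm{span}_{\mathbb{Q}_0^+}$ denotes nonnegative rational linear combinations. For a holomorphic map $F$, $\bar F(\xi):=\overline{F(\bar\xi)}$; $a\cdot b=\sum_ia_ib_i$. Powers are principal branches. A holomorphic map is Nash algebraic if each component satisfies a nontrivial polynomial equation with polynomial coefficients in $z$. *)

theory Defs
  imports "HOL-Analysis.Analysis"
begin

definition holo_on :: "(complex^'n) set \<Rightarrow> (complex^'n \<Rightarrow> complex) \<Rightarrow> bool" where
  "holo_on S f \<longleftrightarrow> (\<forall>z\<in>S. \<exists>L. (f has_derivative L) (at z) \<and>
       (\<forall>h. L (\<i> *s h) = \<i> * L h))"

definition holo2_on :: "((complex^'n) \<times> (complex^'n)) set \<Rightarrow> ((complex^'n) \<times> (complex^'n) \<Rightarrow> complex) \<Rightarrow> bool" where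
  "holo2_on S f \<longleftrightarrow> (\<forall>p\<in>S. \<exists>L. (f has_derivative L) (at p) \<and>
       (\<forall>h. L (\<i> *s fst h, \<i> *s snd h) = \<i> * L h))"

definition holo_map_on :: "(complex^'n) set \<Rightarrow> nat \<Rightarrow> (complex^'n \<Rightarrow> nat \<Rightarrow> complex) \<Rightarrow> bool" where
  "holo_map_on S N F \<longleftrightarrow> (\<forall>i<N. holo_on S (\<lambda>z. F z i))"

text \<open>Polynomials in finitely many variables (indexed by the finite type 'v) and one extra
variable w: coefficient functions with finite support on (multi-index, power of w).\<close>
definition monom :: "('v::finite \<Rightarrow> nat) \<Rightarrow> ('v \<Rightarrow> complex) \<Rightarrow> complex" where
  "monom \<alpha> x = (\<Prod>i\<in>UNIV. x i ^ \<alpha> i)"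

definition is_poly :: "(('v::finite \<Rightarrow> nat) \<times> nat \<Rightarrow> complex) \<Rightarrow> bool" where
  "is_poly P \<longleftrightarrow> finite {p. P p \<noteq> 0}"

definition poly_eval :: "(('v::finite \<Rightarrow> nat) \<times> nat \<Rightarrow> complex) \<Rightarrow> ('v \<Rightarrow> complex) \<Rightarrow> complex \<Rightarrow> complex" where
  "poly_eval P x w = (\<Sum>p\<in>{p. P p \<noteq> 0}. P p * monom (fst p) x * w ^ snd p)"

definition algebraic_fun_on :: "('v::finite \<Rightarrow> complex) set \<Rightarrow> (('v \<Rightarrow> complex) \<Rightarrow> complex) \<Rightarrow> bool" where
  "algebraic_fun_on S f \<longleftrightarrow>
     (\<exists>P. is_poly P \<and> P \<noteq> (\<lambda>_. 0) \<and> (\<forall>x\<in>S. poly_eval P x (f x) = 0))"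

definition nash_algebraic_on :: "(complex^'n::finite) set \<Rightarrow> nat \<Rightarrow> (complex^'n \<Rightarrow> nat \<Rightarrow> complex) \<Rightarrow> bool" where
  "nash_algebraic_on S N F \<longleftrightarrow> holo_map_on S N F \<and>
     (\<forall>i<N. algebraic_fun_on ((\<lambda>z i. z $ i) ` S) (\<lambda>x. F (\<chi> i. x i) i))"

definition algebraic2_on :: "((complex^'n::finite) \<times> (complex^'n)) set \<Rightarrow> ((complex^'n) \<times> (complex^'n) \<Rightarrow> complex) \<Rightarrow> bool" where
  "algebraic2_on S f \<longleftrightarrow>
     algebraic_fun_on ((\<lambda>(z,\<xi>). case_sum (\<lambda>i. z $ i) (\<lambda>i. \<xi> $ i)) ` S)
       (\<lambda>x. f (\<chi> i. x (Inl i), \<chi> i. x (Inr i)))"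

definition vconj :: "complex^'n \<Rightarrow> complex^'n" where
  "vconj \<xi> = (\<chi> i. cnj (\<xi> $ i))"

definition bar_map :: "(complex^'n \<Rightarrow> nat \<Rightarrow> complex) \<Rightarrow> complex^'n \<Rightarrow> nat \<Rightarrow> complex" where
  "bar_map F \<xi> = (\<lambda>i. cnj (F (vconj \<xi>) i))"

definition cdot :: "nat \<Rightarrow> (nat \<Rightarrow> complex) \<Rightarrow> (nat \<Rightarrow> complex) \<Rightarrow> complex" where
  "cdot N a b = (\<Sum>i<N. a i * b i)"

definition nonneg_rat_span :: "real set \<Rightarrow> real set" where
  "nonneg_rat_span A = {(\<Sum>a\<in>A. of_rat (c a) * a) | c. \<forall>a\<in>A. c a \<ge> 0}"

end

(*
Fix z, restrict the second variable to a curve t |-> xi(t) through 0, and read the identity as one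
between power series in t over a field L containing the functions of z.  Logarithmic
differentiation in t turns it into  sum_i c_i f_i'/f_i = Phi'/Phi,  where the f_i are the factors,
c_i the exponents mu_l and -lambda_j, and the coefficients of Phi are algebraic over C(z).

Let V be a valuation ring of L containing C(z); it contains all algebraic elements.  The
coefficients of f_i span a finite-dimensional complex space, so one of them dominates the others
with respect to V.  Dividing f_i by it and reducing modulo the maximal ideal gives a nonzero power
series over the residue field, of order d_i in t, and d_i > 0 unless all coefficients of f_i lie in
V, because f_i has constant term 1.  Comparing residues at t = 0 in the reduced identity yields
sum_i c_i d_i = 0, so all d_i vanish by the hypothesis on the spans.  Hence the coefficients of
f_i lie in every such V and are therefore algebraic.

These coefficients are the pairings of F_l(z) with the Taylor coefficients of conj F_l along the
curve.  A vector orthogonal to all of them is orthogonal to the values of F_l, so the Hermitian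
product on C^N recovers each component of F_l from such pairings.
*)
theory Submission
  imports Defs "HOL-Complex_Analysis.Complex_Analysis"
begin

section \<open>Valuation rings and algebraic elements\<close>

text \<open>The exponents are arbitrary reals, so no integral power turns the identity into an
  algebraic one. The logarithmic derivative makes them mere complex coefficients, and nonzero
  complex constants are units of every V; this is why a relation that holds modulo the maximal ideal
  is an honest relation between the exponents and the orders d_i. It reads sum mu_l d_l = sum
  lambda_j d_j with natural d's, so its two sides are a common element of both spans, hence 0, and
  positivity of the exponents kills every d. The curves are xi_i(t) = eta_i t^(e_i), with one weight
  vector e for all eta. The weights are fitted to the equation of phi: distinct monomials in xi
  become distinct powers of t, so the equation does not degenerate on the curve. The points eta,
  reached at t = 1, range over the ball off the coordinate hyperplanes, so all curves together see
  enough values of the maps. The link between valuations and algebraicity is Chevalley's extension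
  argument: the elements algebraic over a subfield K form the intersection of the valuation rings
  containing K.\<close>

definition is_subring :: "'a::comm_ring_1 set \<Rightarrow> bool" where
  "is_subring S \<longleftrightarrow> 1 \<in> S \<and> (\<forall>x\<in>S. \<forall>y\<in>S. x - y \<in> S \<and> x * y \<in> S)"

definition is_subfield :: "'a::field set \<Rightarrow> bool" where
  "is_subfield K \<longleftrightarrow> is_subring K \<and> (\<forall>x\<in>K. inverse x \<in> K)"

definition val_ring :: "'a::field set \<Rightarrow> bool" where
  "val_ring V \<longleftrightarrow> is_subring V \<and> (\<forall>x. x \<in> V \<or> inverse x \<in> V)"

definition val_ideal :: "'a::field set \<Rightarrow> 'a set" where
  "val_ideal V = {x \<in> V. x = 0 \<or> inverse x \<notin> V}"

definition alg_over :: "'a::field set \<Rightarrow> 'a \<Rightarrow> bool" where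
  "alg_over K x \<longleftrightarrow> (\<exists>p. p \<noteq> 0 \<and> (\<forall>i. coeff p i \<in> K) \<and> poly p x = 0)"

definition adjoin :: "'a::comm_ring_1 set \<Rightarrow> 'a \<Rightarrow> 'a set" where
  "adjoin S u = {poly p u | p. \<forall>i. coeff p i \<in> S}"

context
  fixes S :: "'a::comm_ring_1 set"
  assumes S: "is_subring S"
begin

lemma subring_one: "1 \<in> S"
  using S by (auto simp: is_subring_def)

lemma subring_diff: "x \<in> S \<Longrightarrow> y \<in> S \<Longrightarrow> x - y \<in> S"
  using S by (auto simp: is_subring_def)

lemma subring_mult: "x \<in> S \<Longrightarrow> y \<in> S \<Longrightarrow> x * y \<in> S"
  using S by (auto simp: is_subring_def)

lemma subring_zero: "0 \<in> S"
  using subring_diff[OF subring_one subring_one] by simp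

lemma subring_uminus: "x \<in> S \<Longrightarrow> - x \<in> S"
  using subring_diff[OF subring_zero] by fastforce

lemma subring_add: "x \<in> S \<Longrightarrow> y \<in> S \<Longrightarrow> x + y \<in> S"
  using subring_diff[of x "- y"] subring_uminus[of y] by simp

lemma subring_power: "x \<in> S \<Longrightarrow> x ^ n \<in> S"
  by (induction n) (auto intro: subring_one subring_mult)

lemma subring_sum: "(\<And>i. i \<in> I \<Longrightarrow> f i \<in> S) \<Longrightarrow> sum f I \<in> S"
  by (induction I rule: infinite_finite_induct) (auto intro: subring_zero subring_add)

lemma subring_prod: "(\<And>i. i \<in> I \<Longrightarrow> f i \<in> S) \<Longrightarrow> prod f I \<in> S"
  by (induction I rule: infinite_finite_induct) (auto intro: subring_one subring_mult)

lemma subring_of_nat: "of_nat n \<in> S"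
  by (induction n) (auto intro: subring_zero subring_one subring_add)

lemma subring_poly: "(\<And>i. coeff p i \<in> S) \<Longrightarrow> x \<in> S \<Longrightarrow> poly p x \<in> S"
  by (simp add: poly_altdef subring_sum subring_mult subring_power)

lemmas subring_closed = subring_one subring_zero subring_diff subring_mult subring_uminus
  subring_add subring_power subring_sum subring_prod subring_of_nat

lemma subring_adjoin: "is_subring (adjoin S u)"
  unfolding is_subring_def
proof (intro conjI ballI)
  have "poly 1 u = 1 \<and> (\<forall>i. coeff (1 :: 'a poly) i \<in> S)"
    by (auto intro: subring_zero subring_one simp: one_pCons coeff_pCons split: nat.split)
  then show "1 \<in> adjoin S u"
    unfolding adjoin_def by (intro CollectI exI[of _ 1]) auto
next
  fix x y assume "x \<in> adjoin S u" "y \<in> adjoin S u"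
  then obtain p q where p: "x = poly p u" "\<forall>i. coeff p i \<in> S"
    and q: "y = poly q u" "\<forall>i. coeff q i \<in> S"
    unfolding adjoin_def by auto
  have "x - y = poly (p - q) u \<and> (\<forall>i. coeff (p - q) i \<in> S)"
    using p q by (auto intro: subring_closed)
  then show "x - y \<in> adjoin S u" unfolding adjoin_def by blast
  have "x * y = poly (p * q) u \<and> (\<forall>i. coeff (p * q) i \<in> S)"
    using p q by (auto intro!: subring_closed simp: coeff_mult)
  then show "x * y \<in> adjoin S u" unfolding adjoin_def by blast
qed

lemma adjoin_superset: "S \<subseteq> adjoin S u"
proof
  fix s assume "s \<in> S"
  then have "s = poly [:s:] u \<and> (\<forall>i. coeff [:s:] i \<in> S)"
    by (auto simp: coeff_pCons split: nat.split intro: subring_zero)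
  then show "s \<in> adjoin S u" unfolding adjoin_def by blast
qed

lemma adjoin_self: "u \<in> adjoin S u"
proof -
  have "u = poly [:0, 1:] u \<and> (\<forall>i. coeff [:0, 1:] i \<in> S)"
    by (auto simp: coeff_pCons split: nat.split intro: subring_zero subring_one)
  then show ?thesis unfolding adjoin_def by blast
qed

end

section \<open>Algebraic elements as an intersection of valuation rings\<close>

lemma coeff_reflect_poly_in:
  "(\<And>i. coeff p i \<in> S) \<Longrightarrow> 0 \<in> S \<Longrightarrow> coeff (reflect_poly p) i \<in> S"
  by (simp add: coeff_reflect_poly)

text \<open>Valuation rings are integrally closed: if x were outside V, then y = 1/x would lie in V,
  and dividing the equation of x by x^(n-1) and by its leading coefficient, which is invertible in
  K, writes x as a polynomial in y over V.\<close>

lemma val_ring_algebraic: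
  assumes V: "val_ring V" and K: "is_subfield K" "K \<subseteq> V" and x: "alg_over K x"
  shows "x \<in> V"
proof (rule ccontr)
  assume nx: "x \<notin> V"
  define y where "y = inverse x"
  have sr: "is_subring V" and y: "y \<in> V" using V nx by (auto simp: val_ring_def y_def)
  note cl = subring_closed[OF sr]
  have x0: "x \<noteq> 0" using nx cl(2) by auto
  obtain p where p: "p \<noteq> 0" "\<And>i. coeff p i \<in> K" "poly p x = 0"
    using x by (auto simp: alg_over_def)
  define n where "n = degree p"
  define c where "c = coeff p n"
  have c0: "c \<noteq> 0" using p(1) by (simp add: c_def n_def)
  have cK: "inverse c \<in> V" using K p(2) by (auto simp: is_subfield_def c_def)
  have n0: "n > 0"
  proof (rule ccontr)
    assume "\<not> n > 0"
    then obtain a where "p = [:a:]" unfolding n_def by (metis degree_eq_zeroE neq0_conv)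
    then show False using p by auto
  qed
  have "0 = (\<Sum>i<n. coeff p i * x ^ i) + c * x ^ n"
    using p(3) by (simp add: poly_altdef n_def c_def lessThan_Suc_atMost[symmetric])
  then have "x ^ n = - inverse c * (\<Sum>i<n. coeff p i * x ^ i)"
    using c0 by (simp add: field_simps eq_neg_iff_add_eq_0)
  then have "x ^ n * y ^ (n - 1) = - inverse c * (\<Sum>i<n. coeff p i * (x ^ i * y ^ (n - 1)))"
    by (simp add: sum_distrib_right mult.assoc)
  also have "(\<Sum>i<n. coeff p i * (x ^ i * y ^ (n - 1))) = (\<Sum>i<n. coeff p i * y ^ (n - 1 - i))"
  proof (rule sum.cong[OF refl])
    fix i assume "i \<in> {..<n}"
    then have "y ^ (n - 1) = y ^ i * y ^ (n - 1 - i)"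
      by (simp flip: power_add)
    moreover have "x ^ i * y ^ i = 1" using x0 by (simp add: y_def flip: power_mult_distrib)
    ultimately show "coeff p i * (x ^ i * y ^ (n - 1)) = coeff p i * y ^ (n - 1 - i)"
      by (metis mult.assoc mult_1)
  qed
  also have "x ^ n * y ^ (n - 1) = x"
  proof -
    have "x ^ n = x * x ^ (n - 1)" using n0 by (metis power_minus_mult mult.commute)
    then show ?thesis using x0 by (simp add: y_def mult.assoc flip: power_mult_distrib)
  qed
  finally have "x = - inverse c * (\<Sum>i<n. coeff p i * y ^ (n - 1 - i))" .
  moreover have "- inverse c * (\<Sum>i<n. coeff p i * y ^ (n - 1 - i)) \<in> V"
    using p(2) K(2) by (intro cl cK y) auto
  ultimately show False using nx by simp
qed

lemma poly_eq_sum_atMost: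
  fixes p :: "'a::comm_ring_1 poly"
  shows "degree p \<le> n \<Longrightarrow> poly p x = (\<Sum>i\<le>n. coeff p i * x ^ i)"
  unfolding poly_altdef by (rule sum.mono_neutral_left) (auto simp: coeff_eq_0)

text \<open>The exchange step of Chevalley's argument. In the expression of x through 1/u the
  constant term s_0 can be absorbed: x - s_0 = x w, where w = 1 - s_0/x is a unit of S. Multiplying
  by 1/(x w), which lies in S, exhibits 1 as a combination of u^(-1), ..., u^(-m) over S. Times u^n
  with m \<le> n, this rewrites u^n through lower powers of u, and the top term of p can be
  replaced.\<close>

lemma adjoin_degree_reduction:
  fixes S :: "'a::field set"
  assumes S: "is_subring S" and x: "x \<notin> S" "inverse x \<in> S"
    and unit: "\<And>s. s \<in> S \<Longrightarrow> inverse (1 - inverse x * s) \<in> S"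
    and u: "u \<noteq> 0"
    and p: "\<And>i. coeff p i \<in> S" "degree p \<le> n" "poly p u = x"
    and p': "\<And>i. coeff p' i \<in> S" "degree p' \<le> m" "poly p' (inverse u) = x"
    and mn: "m \<le> n"
  shows "\<exists>q. (\<forall>i. coeff q i \<in> S) \<and> degree q < n \<and> poly q u = x"
proof -
  note cl = subring_closed[OF S]
  define y where "y = inverse x"
  have x0: "x \<noteq> 0" using x cl(2) by auto
  have yS: "y \<in> S" using x by (simp add: y_def)
  define s where "s = coeff p'"
  have sS: "s i \<in> S" for i using p' by (simp add: s_def)
  define w where "w = 1 - y * s 0"
  have wS: "inverse w \<in> S" using unit[OF sS] by (simp add: w_def y_def)
  have w0: "w \<noteq> 0"
  proof
    assume "w = 0"
    then have "x = s 0" using x0 by (simp add: w_def y_def field_simps)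
    then show False using x sS by auto
  qed
  have "x = (\<Sum>j\<le>m. s j * inverse u ^ j)"
    using p'(2,3) by (simp add: s_def poly_eq_sum_atMost)
  also have "\<dots> = s 0 + (\<Sum>j=1..m. s j * inverse u ^ j)"
    by (simp add: atMost_atLeast0 sum.atLeast_Suc_atMost)
  finally have "x - s 0 = (\<Sum>j=1..m. s j * inverse u ^ j)"
    by (simp add: diff_eq_eq)
  moreover have "x * w = x - s 0"
    using x0 unfolding w_def y_def right_diff_distrib by (simp flip: mult.assoc)
  ultimately have xw: "x * w = (\<Sum>j=1..m. s j * inverse u ^ j)"
    by simp
  have "y * x = 1" "inverse w * w = 1" using x0 w0 by (auto simp: y_def)
  then have "1 = y * inverse w * (x * w)"
    by (metis mult.assoc mult.commute mult_1)
  then have one: "1 = y * inverse w * (\<Sum>j=1..m. s j * inverse u ^ j)"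
    by (rule back_subst[where P = "\<lambda>c. 1 = y * inverse w * c", OF _ xw])
  have m0: "m > 0"
  proof (rule ccontr)
    assume "\<not> m > 0"
    then have "(\<Sum>j=1..m. s j * inverse u ^ j) = 0" by simp
    then show False using one by (metis mult_zero_right zero_neq_one)
  qed
  define t where "t j = y * inverse w * s j" for j
  have tS: "t j \<in> S" for j unfolding t_def by (intro cl yS wS sS)
  have un: "u ^ n = (\<Sum>j=1..m. t j * u ^ (n - j))"
  proof -
    have "u ^ n = u ^ n * (y * inverse w * (\<Sum>j=1..m. s j * inverse u ^ j))"
      by (simp only: one[symmetric] mult_1_right)
    also have "\<dots> = (\<Sum>j=1..m. u ^ n * (y * inverse w * (s j * inverse u ^ j)))"
      by (simp only: sum_distrib_left)
    also have "\<dots> = (\<Sum>j=1..m. t j * u ^ (n - j))"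
    proof (rule sum.cong[OF refl])
      fix j assume "j \<in> {1..m}"
      then have "u ^ n = u ^ (n - j) * u ^ j" using mn by (simp flip: power_add)
      moreover have "u ^ j * inverse u ^ j = 1" using u by (simp flip: power_mult_distrib)
      ultimately have "u ^ n * inverse u ^ j = u ^ (n - j)" by (metis mult.assoc mult.right_neutral)
      moreover have "u ^ n * (y * inverse w * (s j * inverse u ^ j)) = t j * (u ^ n * inverse u ^ j)"
        unfolding t_def by (simp only: mult_ac)
      ultimately show "u ^ n * (y * inverse w * (s j * inverse u ^ j)) = t j * u ^ (n - j)"
        by (simp only:)
    qed
    finally show ?thesis .
  qed
  define q where "q = p - Polynomial.monom (coeff p n) n
     + (\<Sum>j=1..m. Polynomial.monom (coeff p n * t j) (n - j))"
  have "(\<Sum>j=1..m. coeff p n * t j * u ^ (n - j)) = coeff p n * u ^ n"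
    unfolding un sum_distrib_left by (simp add: mult.assoc)
  then have "poly q u = x"
    by (simp add: q_def poly_monom poly_sum p(3))
  moreover have "coeff q i \<in> S" for i
  proof -
    have mon: "coeff (Polynomial.monom c k) i \<in> S" if "c \<in> S" for c k
      using that cl(2) by simp
    show ?thesis
      unfolding q_def coeff_diff coeff_add coeff_sum
      by (intro cl(3,6,8) mon cl(4) p(1) tS)
  qed
  moreover have "degree q < n"
  proof -
    have "degree q \<le> n - 1"
    proof (rule degree_le, intro allI impI)
      fix i assume i: "n - 1 < i"
      have "(\<Sum>j=1..m. coeff (Polynomial.monom (coeff p n * t j) (n - j)) i) = 0"
        using i mn by (intro sum.neutral) (auto simp: coeff_monom)
      moreover have "coeff (p - Polynomial.monom (coeff p n) n) i = 0"
        using i p(2) by (cases "i = n") (auto simp: coeff_monom coeff_eq_0)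
      ultimately show "coeff q i = 0" by (simp add: q_def coeff_sum)
    qed
    then show ?thesis using m0 mn by linarith
  qed
  ultimately show ?thesis by blast
qed

text \<open>By maximality, adjoining any u \<notin> S captures x. If u and 1/u were both outside S,
  then x would have expressions of least degree in u and in 1/u, and the longer of the two could be
  shortened.\<close>

lemma maximal_subring_val_ring:
  fixes S :: "'a::field set"
  assumes S: "is_subring S" and x: "x \<notin> S" "inverse x \<in> S"
    and max: "\<And>T. is_subring T \<Longrightarrow> S \<subseteq> T \<Longrightarrow> x \<notin> T \<Longrightarrow> T = S"
  shows "val_ring S"
proof -
  note cl = subring_closed[OF S]
  define y where "y = inverse x"
  have x0: "x \<noteq> 0" using x cl(2) by auto
  have yS: "y \<in> S" using x by (simp add: y_def)
  have ex: "\<exists>p. (\<forall>i. coeff p i \<in> S) \<and> poly p u = x" if "u \<notin> S" for u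
  proof -
    have "x \<in> adjoin S u"
      using max[OF subring_adjoin[OF S] adjoin_superset[OF S], of u] adjoin_self[OF S] that by auto
    then show ?thesis by (auto simp: adjoin_def)
  qed
  \<comment> \<open>If 1/w were outside S for w = 1 - s/x, then x would be a polynomial in 1/w, say
    of degree N, so x w^N \<in> S. But w^N = 1 - s'/x with s' \<in> S, so x w^N = x - s' and x
    itself would lie in S.\<close>
  have unit: "inverse (1 - inverse x * s) \<in> S" if s: "s \<in> S" for s
  proof (rule ccontr)
    define w where "w = 1 - y * s"
    assume "inverse (1 - inverse x * s) \<notin> S"
    then have "inverse w \<notin> S" by (simp add: w_def y_def)
    then obtain p where p: "\<forall>i. coeff p i \<in> S" "poly p (inverse w) = x"
      and w0: "w \<noteq> 0"
      using ex cl(2) by (metis inverse_zero)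
    have wS: "w \<in> S" unfolding w_def by (intro cl s yS)
    have pw: "\<exists>s'\<in>S. w ^ N = 1 - y * s'" for N
    proof (induction N)
      case 0
      then show ?case using cl(2) by (intro bexI[of _ 0]) auto
    next
      case (Suc N)
      then obtain s' where s': "s' \<in> S" "w ^ N = 1 - y * s'" by blast
      have "w ^ Suc N = (1 - y * s) * (1 - y * s')"
        by (simp add: s'(2)) (simp add: w_def)
      then have "w ^ Suc N = 1 - y * (s + s' - y * s * s')"
        by (simp add: algebra_simps)
      then show ?case using s s' yS by (intro bexI[of _ "s + s' - y * s * s'"]) (auto intro!: cl)
    qed
    then obtain s' where s': "s' \<in> S" "w ^ degree p = 1 - y * s'" by blast
    have "poly (reflect_poly p) w = w ^ degree p * x"
      using w0 p by (simp add: poly_reflect_poly_nz)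
    also have "\<dots> = x - s'" using x0 by (simp add: s' y_def algebra_simps)
    finally have "x = poly (reflect_poly p) w + s'" by simp
    moreover have "poly (reflect_poly p) w \<in> S"
      using p wS by (intro subring_poly[OF S] coeff_reflect_poly_in) (auto intro: cl)
    ultimately show False using x s' cl(6) by metis
  qed
  have "u \<in> S \<or> inverse u \<in> S" for u
  proof (rule ccontr)
    assume u: "\<not> (u \<in> S \<or> inverse u \<in> S)"
    then have u0: "u \<noteq> 0" using cl(2) by auto
    define P where "P v n \<longleftrightarrow> (\<exists>p. (\<forall>i. coeff p i \<in> S) \<and> degree p \<le> n \<and> poly p v = x)" for v n
    have "\<exists>n. P u n" "\<exists>n. P (inverse u) n" using u ex unfolding P_def by blast+
    then obtain n m where n: "P u n" "\<And>k. k < n \<Longrightarrow> \<not> P u k"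
      and m: "P (inverse u) m" "\<And>k. k < m \<Longrightarrow> \<not> P (inverse u) k"
      by (metis LeastI not_less_Least)
    obtain p p' where p: "\<And>i. coeff p i \<in> S" "degree p \<le> n" "poly p u = x"
      and p': "\<And>i. coeff p' i \<in> S" "degree p' \<le> m" "poly p' (inverse u) = x"
      using n(1) m(1) unfolding P_def by blast
    show False
    proof (cases "m \<le> n")
      case True
      then show False
        using adjoin_degree_reduction[OF S x unit u0 p p' True] n(2) unfolding P_def by blast
    next
      case False
      have "n \<le> m" "inverse u \<noteq> 0" "poly p (inverse (inverse u)) = x"
        using False u0 p by auto
      then show False
        using adjoin_degree_reduction[where u = "inverse u", OF S x unit _ p' p(1,2)] m(2)
        unfolding P_def by blast
    qed
  qed
  then show ?thesis using S by (auto simp: val_ring_def)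
qed

text \<open>Zorn's lemma on the subrings that contain K and 1/x but not x. The smallest candidate
  K[1/x] is admissible because x is not algebraic.\<close>

lemma ex_val_ring_avoiding:
  fixes K :: "'a::field set"
  assumes K: "is_subfield K" and x: "\<not> alg_over K x"
  shows "\<exists>V. val_ring V \<and> K \<subseteq> V \<and> x \<notin> V"
proof -
  have KS: "is_subring K" using K by (simp add: is_subfield_def)
  note cl = subring_closed[OF KS]
  have x0: "x \<noteq> 0"
  proof
    assume "x = 0"
    then have "alg_over K x" unfolding alg_over_def
      by (intro exI[of _ "[:0, 1:]"]) (auto simp: coeff_pCons split: nat.split intro: cl)
    then show False using x by simp
  qed
  define \<A> where "\<A> = {S. is_subring S \<and> K \<subseteq> S \<and> inverse x \<in> S \<and> x \<notin> S}"
  have start: "adjoin K (inverse x) \<in> \<A>"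
  proof -
    have "x \<notin> adjoin K (inverse x)"
    proof
      assume "x \<in> adjoin K (inverse x)"
      then obtain p where p: "x = poly p (inverse x)" "\<forall>i. coeff p i \<in> K"
        unfolding adjoin_def by blast
      \<comment> \<open>Clearing denominators in x = p(1/x) yields an equation for x over K. The
        reflected polynomial has degree at most \<open>degree p\<close>, so the added power of x is
        not cancelled and q is nonzero.\<close>
      define q where "q = Polynomial.monom 1 (Suc (degree p)) - reflect_poly p"
      have "coeff (reflect_poly p) (Suc (degree p)) = 0"
        by (simp add: coeff_reflect_poly)
      then have "coeff q (Suc (degree p)) = 1"
        by (simp add: q_def coeff_monom)
      then have "q \<noteq> 0" by auto
      moreover have "poly q x = 0"
        using x0 p(1)[symmetric] by (simp add: q_def poly_monom poly_reflect_poly_nz)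
      moreover have "coeff q i \<in> K" for i
        unfolding q_def coeff_diff coeff_monom
        using p by (intro cl coeff_reflect_poly_in) (auto intro: cl)
      ultimately show False using x by (auto simp: alg_over_def)
    qed
    then show ?thesis
      unfolding \<A>_def using subring_adjoin[OF KS] adjoin_superset[OF KS] adjoin_self[OF KS] by auto
  qed
  have "\<exists>M\<in>\<A>. \<forall>X\<in>\<A>. M \<subseteq> X \<longrightarrow> X = M"
  proof (rule subset_Zorn_nonempty)
    show "\<A> \<noteq> {}" using start by blast
  next
    fix \<C> assume ne: "\<C> \<noteq> {}" and ch: "subset.chain \<A> \<C>"
    have sub: "\<C> \<subseteq> \<A>" using ch by (simp add: subset_chain_def)
    have "is_subring (\<Union>\<C>)"
      unfolding is_subring_def
    proof (intro conjI ballI)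
      show "1 \<in> \<Union>\<C>" using ne sub by (force simp: \<A>_def is_subring_def)
    next
      fix a b assume "a \<in> \<Union>\<C>" "b \<in> \<Union>\<C>"
      then obtain A B where AB: "A \<in> \<C>" "a \<in> A" "B \<in> \<C>" "b \<in> B" by blast
      then have "A \<subseteq> B \<or> B \<subseteq> A" using ch by (auto simp: subset_chain_def)
      then obtain C where "C \<in> \<C>" "a \<in> C" "b \<in> C" using AB by blast
      moreover have "is_subring C" using \<open>C \<in> \<C>\<close> sub by (auto simp: \<A>_def)
      ultimately show "a - b \<in> \<Union>\<C>" "a * b \<in> \<Union>\<C>"
        by (auto simp: is_subring_def)
    qed
    then show "\<Union>\<C> \<in> \<A>" using ne sub by (auto simp: \<A>_def)
  qed
  then obtain M where M: "M \<in> \<A>" "\<And>X. X \<in> \<A> \<Longrightarrow> M \<subseteq> X \<Longrightarrow> X = M" by blast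
  have "val_ring M"
    using M by (intro maximal_subring_val_ring[of M x]) (auto simp: \<A>_def)
  then show ?thesis using M(1) by (auto simp: \<A>_def)
qed

text \<open>Turns algebraicity into a condition tested in one valuation ring at a time. Closure
  under ring operations and transitivity then come for free, since an intersection of rings is a
  ring.\<close>

lemma alg_over_iff_val_ring:
  assumes "is_subfield K"
  shows "alg_over K x \<longleftrightarrow> (\<forall>V. val_ring V \<longrightarrow> K \<subseteq> V \<longrightarrow> x \<in> V)"
  using assms ex_val_ring_avoiding val_ring_algebraic by blast

lemma subfield_algebraic_closure:
  assumes K: "is_subfield K"
  shows "is_subfield {x. alg_over K x}"
proof -
  have "is_subring {x. alg_over K x}"
    unfolding alg_over_iff_val_ring[OF K] is_subring_def val_ring_def by blast
  moreover have "alg_over K (inverse x)" if "alg_over K x" for x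
  proof (cases "x = 0")
    case False
    obtain p where p: "p \<noteq> 0" "\<forall>i. coeff p i \<in> K" "poly p x = 0"
      using \<open>alg_over K x\<close> by (auto simp: alg_over_def)
    have z: "0 \<in> K" using K subring_zero by (auto simp: is_subfield_def)
    have "poly (reflect_poly p) (inverse x) = 0"
      using poly_reflect_poly_nz[of "inverse x" p] False p by simp
    then show ?thesis unfolding alg_over_def
      using p coeff_reflect_poly_in[of p K] z by (intro exI[of _ "reflect_poly p"]) auto
  qed (use that in auto)
  ultimately show ?thesis by (auto simp: is_subfield_def)
qed

lemma alg_over_algebraic_closure:
  assumes K: "is_subfield K" and x: "alg_over {x. alg_over K x} x"
  shows "alg_over K x"
  unfolding alg_over_iff_val_ring[OF K]
  using val_ring_algebraic[OF _ subfield_algebraic_closure[OF K] _ x] val_ring_algebraic[OF _ K]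
  by blast

section \<open>Power series over a valued field\<close>

unbundle no vec_syntax

section \<open>Coefficients of algebraic power series\<close>

lemma subring_coeffwise_fps:
  assumes S: "is_subring S"
  shows "is_subring {f :: 'a::comm_ring_1 fps. \<forall>n. f $ n \<in> S}"
  unfolding is_subring_def
  using subring_zero[OF S] subring_one[OF S]
  by (auto simp: fps_mult_nth intro!: subring_diff[OF S] subring_sum[OF S] subring_mult[OF S])

lemma subring_coeffwise_poly:
  assumes S: "is_subring S"
  shows "is_subring {p :: 'a::comm_ring_1 poly. \<forall>i. coeff p i \<in> S}"
  unfolding is_subring_def
  using subring_zero[OF S] subring_one[OF S]
  by (auto simp: coeff_mult one_pCons coeff_pCons split: nat.split
      intro!: subring_diff[OF S] subring_sum[OF S] subring_mult[OF S])

lemma pcompose_coeffs_in: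
  assumes S: "is_subring S" and p: "\<And>i. coeff p i \<in> S" and q: "\<And>i. coeff q i \<in> S"
  shows "coeff (pcompose p q) i \<in> S"
proof -
  let ?R = "{p. \<forall>i. coeff p i \<in> S}"
  have R: "is_subring ?R" by (rule subring_coeffwise_poly[OF S])
  have "p \<in> ?R \<Longrightarrow> pcompose p q \<in> ?R"
  proof (induction p)
    case 0
    then show ?case by simp
  next
    case (pCons a p)
    have "coeff p i \<in> S" for i using pCons.prems by (auto simp: coeff_pCons dest: spec[of _ "Suc i"])
    then have "pcompose p q \<in> ?R" using pCons.IH by auto
    moreover have "a \<in> S" using pCons.prems by (auto dest: spec[of _ 0])
    then have "[:a:] \<in> ?R" by (auto simp: coeff_pCons subring_zero[OF S] split: nat.split)
    moreover have "q \<in> ?R" using q by auto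
    ultimately show ?case
      unfolding pcompose_pCons by (intro subring_add[OF R] subring_mult[OF R])
  qed
  then show ?thesis using p by auto
qed

text \<open>Let s be the least order in the series variable among the coefficients of Q. In degree s
  of the equation Q(\<Phi>) = 0 only the constant terms of the powers of \<Phi> survive, and they
  satisfy a polynomial equation that is nonzero by the choice of s.\<close>

lemma fps_root_nth_0:
  fixes \<Phi> :: "'a::field fps"
  assumes Q: "Q \<noteq> 0" "\<And>i n. coeff Q i $ n \<in> K" and r: "poly Q \<Phi> = 0"
  shows "alg_over K (\<Phi> $ 0)"
proof -
  have "\<exists>s i. coeff Q i $ s \<noteq> 0"
    using Q(1) by (metis fps_ext fps_zero_nth leading_coeff_neq_0)
  then obtain s where s: "\<exists>i. coeff Q i $ s \<noteq> 0" "\<And>k. k < s \<Longrightarrow> \<forall>i. coeff Q i $ k = 0"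
    using exists_least_iff[of "\<lambda>s. \<exists>i. coeff Q i $ s \<noteq> 0"] by blast
  define p where "p = map_poly (\<lambda>c. c $ s) Q"
  have cp: "coeff p i = coeff Q i $ s" for i by (simp add: p_def coeff_map_poly)
  have "p \<noteq> 0" using s(1) cp by (metis coeff_0)
  have "degree p \<le> degree Q" by (rule degree_le) (auto simp: cp coeff_eq_0)
  then have "poly p (\<Phi> $ 0) = (\<Sum>i\<le>degree Q. coeff Q i $ s * (\<Phi> ^ i) $ 0)"
    by (simp add: poly_eq_sum_atMost cp fps_nth_power_0)
  also have "\<dots> = (\<Sum>i\<le>degree Q. (coeff Q i * \<Phi> ^ i) $ s)"
  proof (rule sum.cong[OF refl])
    fix i
    have "(coeff Q i * \<Phi> ^ i) $ s = (\<Sum>k=0..s. if k = s then coeff Q i $ s * (\<Phi> ^ i) $ 0 else 0)"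
      unfolding fps_mult_nth using s(2) by (intro sum.cong) auto
    then show "coeff Q i $ s * (\<Phi> ^ i) $ 0 = (coeff Q i * \<Phi> ^ i) $ s" by simp
  qed
  also have "\<dots> = poly Q \<Phi> $ s" by (simp add: poly_altdef fps_sum_nth)
  finally have "poly p (\<Phi> $ 0) = 0" using r by simp
  then show ?thesis
    unfolding alg_over_def using \<open>p \<noteq> 0\<close> Q(2) cp by (intro exI[of _ p]) auto
qed

text \<open>Induction through \<Phi> = \<Phi>(0) + X \<Psi>. The series \<Psi> is a root of
  Q(\<Phi>(0) + X T), which has coefficients over K because \<Phi>(0) \<in> K, and is nonzero
  because the inner polynomial has degree 1 in T.\<close>

lemma fps_root_nth:
  fixes \<Phi> :: "'a::field fps"
  assumes K: "is_subring K" "\<And>x. alg_over K x \<Longrightarrow> x \<in> K"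
    and "Q \<noteq> 0" "\<And>i n. coeff Q i $ n \<in> K" "poly Q \<Phi> = 0"
  shows "\<Phi> $ n \<in> K"
  using assms(3-)
proof (induction n arbitrary: Q \<Phi>)
  case 0
  then show ?case using K(2) fps_root_nth_0 by blast
next
  case (Suc n)
  have S: "is_subring {f :: 'a fps. \<forall>n. f $ n \<in> K}"
    by (rule subring_coeffwise_fps[OF K(1)])
  have \<Phi>0: "\<Phi> $ 0 \<in> K" using K(2) fps_root_nth_0[OF Suc.prems] by blast
  define q where "q = [:fps_const (\<Phi> $ 0), fps_X:]"
  define Q' where "Q' = pcompose Q q"
  have "coeff Q' i \<in> {f. \<forall>n. f $ n \<in> K}" for i
    unfolding Q'_def
  proof (rule pcompose_coeffs_in[OF S])
    show "coeff q i \<in> {f. \<forall>n. f $ n \<in> K}" for i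
      using \<Phi>0 subring_closed[OF K(1)]
      by (auto simp: q_def coeff_pCons fps_X_def split: nat.split)
  qed (use Suc.prems in auto)
  moreover have "Q' \<noteq> 0"
    unfolding Q'_def using Suc.prems(1) by (subst pcompose_eq_0_iff) (auto simp: q_def)
  moreover have "poly Q' (fps_shift 1 \<Phi>) = 0"
  proof -
    have "fps_const (\<Phi> $ 0) + fps_shift 1 \<Phi> * fps_X = \<Phi>"
      by (rule fps_ext) auto
    then show ?thesis using Suc.prems(3) by (simp add: Q'_def poly_pcompose q_def)
  qed
  ultimately have "fps_shift 1 \<Phi> $ n \<in> K" using Suc.IH[of Q' "fps_shift 1 \<Phi>"] by blast
  then show ?case by simp
qed

section \<open>Lowest-order terms modulo the maximal ideal\<close>

definition complex_hom :: "(complex \<Rightarrow> 'a::field) \<Rightarrow> bool" where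
  "complex_hom h \<longleftrightarrow> h 1 = 1 \<and> (\<forall>x y. h (x + y) = h x + h y \<and> h (x * y) = h x * h y)"

context
  fixes h :: "complex \<Rightarrow> 'a::field"
  assumes h: "complex_hom h"
begin

lemma chom_simps: "h 1 = 1" "h (x + y) = h x + h y" "h (x * y) = h x * h y"
  using h by (auto simp: complex_hom_def)

lemma chom_zero: "h 0 = 0"
  by (metis add_cancel_right_left add_0 chom_simps(2))

lemma chom_sum: "h (sum f I) = (\<Sum>i\<in>I. h (f i))"
  by (induction I rule: infinite_finite_induct) (auto simp: chom_simps chom_zero)

lemma chom_of_nat: "h (of_nat n) = of_nat n"
  by (induction n) (auto simp: chom_simps chom_zero)

lemma chom_vector_space: "vector_space (\<lambda>c x. h c * x)"
  by standard (auto simp: chom_simps algebra_simps)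

end

context
  fixes V :: "'a::field set"
  assumes V: "val_ring V"
begin

lemma val_subring: "is_subring V"
  using V by (simp add: val_ring_def)

lemma val_ideal_iff_unit: "x \<in> V \<Longrightarrow> x \<notin> val_ideal V \<longleftrightarrow> x \<noteq> 0 \<and> inverse x \<in> V"
  by (auto simp: val_ideal_def)

lemma val_ideal_subset: "val_ideal V \<subseteq> V"
  by (auto simp: val_ideal_def)

lemma val_ideal_zero: "0 \<in> val_ideal V"
  by (auto simp: val_ideal_def subring_zero[OF val_subring])

lemma val_ideal_one: "1 \<notin> val_ideal V"
  by (auto simp: val_ideal_def subring_one[OF val_subring])

lemma val_ideal_mult: "x \<in> V \<Longrightarrow> y \<in> val_ideal V \<Longrightarrow> x * y \<in> val_ideal V"
proof (rule ccontr)
  assume x: "x \<in> V" and y: "y \<in> val_ideal V" and "x * y \<notin> val_ideal V"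
  moreover have yV: "y \<in> V" using y val_ideal_subset by auto
  ultimately have "x * y \<noteq> 0" "inverse (x * y) \<in> V"
    using val_ideal_iff_unit subring_mult[OF val_subring] by blast+
  then have "x * inverse (x * y) \<in> V" using subring_mult[OF val_subring x] by simp
  moreover have "x * inverse (x * y) = inverse y"
    using \<open>x * y \<noteq> 0\<close> by (simp add: field_simps)
  ultimately have "inverse y \<in> V" by (simp only:)
  then show False using y \<open>x * y \<noteq> 0\<close> by (auto simp: val_ideal_def)
qed

lemma val_ideal_mult': "x \<in> val_ideal V \<Longrightarrow> y \<in> V \<Longrightarrow> x * y \<in> val_ideal V"
  using val_ideal_mult[of y x] by (simp add: mult.commute)

lemma val_ideal_add_aux:
  assumes x: "x \<in> val_ideal V" and y: "y \<in> val_ideal V" "y \<noteq> 0" and xy: "x / y \<in> V"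
  shows "x + y \<in> val_ideal V"
proof -
  have "x + y = (1 + x / y) * y" using y by (simp add: field_simps)
  also have "\<dots> \<in> val_ideal V"
    using xy by (intro val_ideal_mult y subring_add[OF val_subring] subring_one[OF val_subring])
  finally show ?thesis .
qed

lemma val_ideal_add:
  assumes x: "x \<in> val_ideal V" and y: "y \<in> val_ideal V"
  shows "x + y \<in> val_ideal V"
proof (cases "x = 0 \<or> y = 0")
  case True
  then show ?thesis using x y by auto
next
  case False
  have "x / y \<in> V \<or> y / x \<in> V"
    using V unfolding val_ring_def by (metis inverse_divide)
  then show ?thesis
    using val_ideal_add_aux[of x y] val_ideal_add_aux[of y x] x y False by (auto simp: add.commute)
qed

lemma val_ideal_uminus: "x \<in> val_ideal V \<Longrightarrow> - x \<in> val_ideal V"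
  using val_ideal_mult[of "- 1" x] subring_uminus[OF val_subring subring_one[OF val_subring]] by simp

lemma val_ideal_diff: "x \<in> val_ideal V \<Longrightarrow> y \<in> val_ideal V \<Longrightarrow> x - y \<in> val_ideal V"
  using val_ideal_add[of x "- y"] val_ideal_uminus[of y] by simp

lemma val_ideal_sum: "(\<And>i. i \<in> I \<Longrightarrow> f i \<in> val_ideal V) \<Longrightarrow> sum f I \<in> val_ideal V"
  by (induction I rule: infinite_finite_induct) (auto intro: val_ideal_zero val_ideal_add)

lemma val_unit_mult:
  assumes "x \<in> V" "x \<notin> val_ideal V" "y \<in> V" "y \<notin> val_ideal V"
  shows "x * y \<notin> val_ideal V"
proof -
  have "inverse (x * y) \<in> V"
    using assms val_ideal_iff_unit by (simp add: subring_mult[OF val_subring])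
  then show ?thesis
    using assms val_ideal_iff_unit subring_mult[OF val_subring] by (metis mult_eq_0_iff)
qed

lemma val_unit_prod:
  "(\<And>i. i \<in> I \<Longrightarrow> a i \<in> V \<and> a i \<notin> val_ideal V) \<Longrightarrow> prod a I \<notin> val_ideal V"
proof (induction I rule: infinite_finite_induct)
  case (insert i I)
  then show ?case
    using val_unit_mult[of "a i" "prod a I"] subring_prod[OF val_subring, of I a] by auto
qed (auto simp: val_ideal_one)

text \<open>Modulo the maximal ideal, f has order at least d, and its coefficient in degree d is the
  residue of a. The residue of a may vanish: this lets summands be compared in one fixed degree even
  when some of them, or their sum, have larger order.\<close>

definition lead :: "'a fps \<Rightarrow> nat \<Rightarrow> 'a \<Rightarrow> bool" where
  "lead f d a \<longleftrightarrow> (\<forall>n. f $ n \<in> V) \<and> (\<forall>n<d. f $ n \<in> val_ideal V) \<and> a \<in> V \<and> f $ d - a \<in> val_ideal V"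

lemma lead_unique: "lead f d a \<Longrightarrow> lead f d b \<Longrightarrow> a - b \<in> val_ideal V"
  using val_ideal_diff[of "f $ d - b" "f $ d - a"] by (simp add: lead_def)

lemma lead_const: "a \<in> V \<Longrightarrow> lead (fps_const a) 0 a"
  by (auto simp: lead_def subring_zero[OF val_subring] val_ideal_zero)

lemma lead_mult:
  assumes f: "lead f d a" and g: "lead g e b"
  shows "lead (f * g) (d + e) (a * b)"
proof -
  note cl = subring_closed[OF val_subring]
  have small: "f $ k * g $ (n - k) \<in> val_ideal V" if "k < d \<or> n - k < e" for k n
    using that f g unfolding lead_def by (auto intro: val_ideal_mult val_ideal_mult')
  have "(f * g) $ n \<in> V" for n
    using f g unfolding lead_def fps_mult_nth by (intro cl) auto
  moreover have "(f * g) $ n \<in> val_ideal V" if "n < d + e" for n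
    unfolding fps_mult_nth using that by (intro val_ideal_sum small) auto
  moreover have "(f * g) $ (d + e) - a * b \<in> val_ideal V"
  proof -
    have "(f * g) $ (d + e) = f $ d * g $ e + (\<Sum>k\<in>{0..d + e} - {d}. f $ k * g $ (d + e - k))"
      unfolding fps_mult_nth by (subst sum.remove[of _ d]) auto
    then have "(f * g) $ (d + e) - a * b = (f $ d - a) * g $ e + a * (g $ e - b)
       + (\<Sum>k\<in>{0..d + e} - {d}. f $ k * g $ (d + e - k))"
      by (simp add: algebra_simps)
    also have "\<dots> \<in> val_ideal V"
    proof (intro val_ideal_add val_ideal_sum small)
      show "(f $ d - a) * g $ e \<in> val_ideal V" "a * (g $ e - b) \<in> val_ideal V"
        using f g unfolding lead_def by (auto intro: val_ideal_mult val_ideal_mult')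
    qed auto
    finally show ?thesis .
  qed
  moreover have "a * b \<in> V" using f g cl unfolding lead_def by auto
  ultimately show ?thesis by (auto simp: lead_def)
qed

lemma lead_prod:
  "finite I \<Longrightarrow> (\<And>i. i \<in> I \<Longrightarrow> lead (f i) (d i) (a i)) \<Longrightarrow> lead (prod f I) (sum d I) (prod a I)"
proof (induction I rule: finite_induct)
  case empty
  then show ?case using lead_const[of 1] subring_one[OF val_subring] by simp
next
  case (insert i I)
  then show ?case using lead_mult[of "f i" "d i" "a i"] by auto
qed

lemma lead_sum:
  assumes "\<And>i. i \<in> I \<Longrightarrow> lead (f i) d (a i)"
  shows "lead (sum f I) d (sum a I)"
proof -
  have "(\<Sum>i\<in>I. f i) $ d - sum a I = (\<Sum>i\<in>I. f i $ d - a i)"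
    by (simp add: fps_sum_nth sum_subtractf)
  then show ?thesis
    using assms unfolding lead_def
    by (auto simp: fps_sum_nth intro!: val_ideal_sum subring_sum[OF val_subring])
qed

text \<open>The Euler operator t d/dt keeps the order, unlike d/dt itself, and multiplies the lowest
  coefficient by d. This is how the order of a factor enters the final relation.\<close>

lemma lead_X_deriv:
  assumes f: "lead f d a"
  shows "lead (fps_X * fps_deriv f) d (of_nat d * a)"
proof -
  have nth: "(fps_X * fps_deriv f) $ n = of_nat n * f $ n" for n
    by (cases n) auto
  have "of_nat d * f $ d - of_nat d * a = of_nat d * (f $ d - a)" by (simp add: algebra_simps)
  then show ?thesis
    using f subring_of_nat[OF val_subring] unfolding lead_def nth
    by (auto intro: subring_mult[OF val_subring] val_ideal_mult)
qed

lemma ex_dominant_element: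
  assumes "finite B" "B \<noteq> {}" "0 \<notin> B"
  shows "\<exists>b\<in>B. \<forall>b'\<in>B. b' / b \<in> V"
  using assms
proof (induction B rule: finite_ne_induct)
  case (singleton x)
  then show ?case using subring_one[OF val_subring] by auto
next
  case (insert x F)
  then obtain b where b: "b \<in> F" "\<forall>b'\<in>F. b' / b \<in> V" by auto
  have nz: "b \<noteq> 0" "x \<noteq> 0" using insert b by auto
  have "x / b \<in> V \<or> b / x \<in> V"
    using V unfolding val_ring_def by (metis inverse_divide)
  then show ?case
  proof
    assume "b / x \<in> V"
    then have "b' / x \<in> V" if "b' \<in> F" for b'
      using subring_mult[OF val_subring, of "b' / b" "b / x"] b that nz by auto
    then show ?thesis using subring_one[OF val_subring] nz by (intro bexI[of _ x]) auto
  qed (use b in auto)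
qed

text \<open>Divisibility in V is a total preorder, so a finite basis has a dominant element b. The z
  with z/b \<in> V form a complex subspace, since constants lie in V; so b dominates the whole
  span.\<close>

lemma ex_dominant_in_finite_span:
  fixes x :: "nat \<Rightarrow> 'a"
  assumes h: "complex_hom h" "range h \<subseteq> V" and T: "finite T"
    and x: "\<And>n. x n = (\<Sum>i\<in>T. h (a n i) * y i)" and x0: "x 0 \<noteq> 0"
  shows "\<exists>m. x m \<noteq> 0 \<and> (\<forall>n. x n / x m \<in> V)"
proof -
  interpret vs: vector_space "\<lambda>c x. h c * x" by (rule chom_vector_space[OF h(1)])
  have sp: "x n \<in> vs.span (y ` T)" for n
    unfolding x by (intro vs.span_sum vs.span_scale vs.span_base) auto
  \<comment> \<open>The basis is taken among the x n themselves, not among the y i, so that the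
    dominant element is one of the coefficients.\<close>
  obtain B where B: "B \<subseteq> range x" "vs.independent B" "range x \<subseteq> vs.span B"
    using vs.maximal_independent_subset by blast
  have fin: "finite B"
    using vs.independent_span_bound[of "y ` T" B] T B sp by blast
  have ne: "B \<noteq> {}"
  proof
    assume "B = {}"
    then have "x 0 \<in> vs.span {}" using B(3) by auto
    then show False using x0 by (simp add: vs.span_empty)
  qed
  have "0 \<notin> B" using B(2) vs.dependent_zero by blast
  then obtain b where b: "b \<in> B" "\<forall>b'\<in>B. b' / b \<in> V" using ex_dominant_element[OF fin ne] by blast
  have "vs.subspace {z. z / b \<in> V}"
    unfolding vs.subspace_def using h(2)
    by (auto simp: add_divide_distrib times_divide_eq_right[symmetric] simp del: times_divide_eq_right
        intro: subring_zero[OF val_subring] subring_add[OF val_subring] subring_mult[OF val_subring])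
  then have "vs.span B \<subseteq> {z. z / b \<in> V}" using b by (intro vs.span_minimal) auto
  then have "\<forall>n. x n / b \<in> V" using B(3) by blast
  moreover have "b \<noteq> 0" using b \<open>0 \<notin> B\<close> by auto
  moreover obtain m where "b = x m" using b B by auto
  ultimately show ?thesis by auto
qed

text \<open>Each \<open>f i\<close> is divided by a dominant coefficient. Modulo the maximal ideal the result has
  order \<open>d i\<close>, and the coefficient of lowest order in the relation is
  \<open>\<Sum>i\<in>I. c i * d i\<close> times a unit.\<close>

lemma log_deriv_relation_coeffs_in:
  fixes f :: "'i \<Rightarrow> 'a fps" and c :: "'i \<Rightarrow> complex"
  assumes h: "complex_hom h" "range h \<subseteq> V" and I: "finite I"
    and f0: "\<And>i. i \<in> I \<Longrightarrow> f i $ 0 = 1"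
    and dom: "\<And>i. i \<in> I \<Longrightarrow> \<exists>m. f i $ m \<noteq> 0 \<and> (\<forall>n. f i $ n / f i $ m \<in> V)"
    and \<Phi>: "\<And>n. \<Phi> $ n \<in> V" "\<Phi> $ 0 = 1"
    and eq: "(\<Sum>i\<in>I. fps_const (h (c i)) * fps_deriv (f i) * (\<Prod>j\<in>I - {i}. f j)) * \<Phi>
       = fps_deriv \<Phi> * (\<Prod>i\<in>I. f i)"
    and indep: "\<And>d. (\<Sum>i\<in>I. c i * of_nat (d i)) = 0 \<Longrightarrow> \<forall>i\<in>I. d i = 0"
  shows "\<forall>i\<in>I. \<forall>n. f i $ n \<in> V"
proof -
  note cl = subring_closed[OF val_subring]
  obtain m where m: "\<And>i. i \<in> I \<Longrightarrow> f i $ m i \<noteq> 0"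
    "\<And>i n. i \<in> I \<Longrightarrow> f i $ n / f i $ m i \<in> V"
    using dom by metis
  define M where "M i = f i $ m i" for i
  define g where "g i = fps_const (inverse (M i)) * f i" for i
  have gV: "g i $ n \<in> V" if "i \<in> I" for i n
    using m(2)[OF that, of n] by (simp add: g_def M_def divide_inverse mult.commute)
  have "g i $ m i = 1" if "i \<in> I" for i using m(1)[OF that] by (simp add: g_def M_def)
  then have "\<exists>n. g i $ n \<notin> val_ideal V" if "i \<in> I" for i using that val_ideal_one by metis
  then have "\<exists>n. g i $ n \<notin> val_ideal V \<and> (\<forall>k<n. g i $ k \<in> val_ideal V)" if "i \<in> I" for i
    using that exists_least_iff[of "\<lambda>n. g i $ n \<notin> val_ideal V"] by blast
  then obtain d where d: "\<And>i. i \<in> I \<Longrightarrow> g i $ d i \<notin> val_ideal V"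
    "\<And>i k. i \<in> I \<Longrightarrow> k < d i \<Longrightarrow> g i $ k \<in> val_ideal V"
    by metis
  define a where "a i = g i $ d i" for i
  have lg: "lead (g i) (d i) (a i)" if "i \<in> I" for i
    using that gV d by (auto simp: lead_def a_def val_ideal_zero)
  have l\<Phi>: "lead \<Phi> 0 1" using \<Phi> cl by (auto simp: lead_def val_ideal_zero)
  \<comment> \<open>Logarithmic derivatives ignore constant factors: in the cleared form both sides
    of the relation just pick up the same factor C.\<close>
  define C where "C = (\<Prod>i\<in>I. fps_const (inverse (M i)))"
  have pg: "(\<Prod>i\<in>I. g i) = C * (\<Prod>i\<in>I. f i)"
    by (simp add: g_def C_def prod.distrib)
  have trm: "fps_const (h (c i)) * fps_deriv (g i) * (\<Prod>j\<in>I - {i}. g j)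
      = C * (fps_const (h (c i)) * fps_deriv (f i) * (\<Prod>j\<in>I - {i}. f j))" if i: "i \<in> I" for i
  proof -
    have "C = fps_const (inverse (M i)) * (\<Prod>j\<in>I - {i}. fps_const (inverse (M j)))"
      unfolding C_def using I i by (rule prod.remove)
    then show ?thesis by (simp add: g_def prod.distrib mult_ac)
  qed
  \<comment> \<open>The additional factor X replaces derivatives by the Euler operator, so that all
    summands share the degree \<open>sum d I\<close>.\<close>
  have eqg: "(\<Sum>i\<in>I. fps_const (h (c i)) * (fps_X * fps_deriv (g i)) * (\<Prod>j\<in>I - {i}. g j)) * \<Phi>
      = (fps_X * fps_deriv \<Phi>) * (\<Prod>i\<in>I. g i)"
  proof -
    have "(\<Sum>i\<in>I. fps_const (h (c i)) * (fps_X * fps_deriv (g i)) * (\<Prod>j\<in>I - {i}. g j))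
       = (\<Sum>i\<in>I. fps_X * (fps_const (h (c i)) * fps_deriv (g i) * (\<Prod>j\<in>I - {i}. g j)))"
      by (simp only: mult_ac)
    also have "\<dots> = (\<Sum>i\<in>I. fps_X * (C * (fps_const (h (c i)) * fps_deriv (f i) * (\<Prod>j\<in>I - {i}. f j))))"
      by (intro sum.cong refl arg_cong[where f = "\<lambda>x. fps_X * x"] trm)
    also have "\<dots> = fps_X * C * (\<Sum>i\<in>I. fps_const (h (c i)) * fps_deriv (f i) * (\<Prod>j\<in>I - {i}. f j))"
      by (simp only: sum_distrib_left mult.assoc)
    finally show ?thesis unfolding pg using eq by (metis (no_types, lifting) mult.assoc mult.commute)
  qed
  have hV: "h x \<in> V" for x using h(2) by auto
  have aV: "a i \<in> V" if "i \<in> I" for i using gV[OF that] by (simp add: a_def)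
  have left: "lead ((\<Sum>i\<in>I. fps_const (h (c i)) * (fps_X * fps_deriv (g i)) * (\<Prod>j\<in>I - {i}. g j)) * \<Phi>)
      (sum d I) ((\<Sum>i\<in>I. h (c i) * of_nat (d i) * prod a I) * 1)"
  proof -
    have "lead (fps_const (h (c i)) * (fps_X * fps_deriv (g i)) * (\<Prod>j\<in>I - {i}. g j))
        (sum d I) (h (c i) * of_nat (d i) * prod a I)" if i: "i \<in> I" for i
    proof -
      have "lead (fps_const (h (c i)) * (fps_X * fps_deriv (g i)) * (\<Prod>j\<in>I - {i}. g j))
        (0 + d i + sum d (I - {i})) (h (c i) * (of_nat (d i) * a i) * prod a (I - {i}))"
        using I i by (intro lead_mult lead_const hV lead_X_deriv lg lead_prod) auto
      moreover have "sum d I = d i + sum d (I - {i})" "prod a I = a i * prod a (I - {i})"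
        using I i by (auto intro: sum.remove prod.remove)
      ultimately show ?thesis by (simp add: mult_ac)
    qed
    then have "lead (\<Sum>i\<in>I. fps_const (h (c i)) * (fps_X * fps_deriv (g i)) * (\<Prod>j\<in>I - {i}. g j))
      (sum d I) (\<Sum>i\<in>I. h (c i) * of_nat (d i) * prod a I)" by (rule lead_sum)
    from lead_mult[OF this l\<Phi>] show ?thesis by simp
  qed
  \<comment> \<open>\<Phi> is a unit series over V, so it has order 0, and the Euler operator
    multiplies its lowest coefficient by 0. The right side therefore contributes nothing in degree
    \<open>sum d I\<close>.\<close>
  have right: "lead ((fps_X * fps_deriv \<Phi>) * (\<Prod>i\<in>I. g i)) (sum d I) 0"
  proof -
    have "lead (fps_X * fps_deriv \<Phi>) 0 0" using lead_X_deriv[OF l\<Phi>] by simp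
    from lead_mult[OF this lead_prod[OF I lg]] show ?thesis by simp
  qed
  define s where "s = (\<Sum>i\<in>I. c i * of_nat (d i))"
  have "(\<Sum>i\<in>I. h (c i) * of_nat (d i) * prod a I) = h s * prod a I"
    by (simp add: s_def chom_sum[OF h(1)] chom_simps[OF h(1)] chom_of_nat[OF h(1)] sum_distrib_right)
  then have "h s * prod a I \<in> val_ideal V"
    using lead_unique[OF left right[folded eqg]] by simp
  moreover have "prod a I \<notin> val_ideal V" by (rule val_unit_prod) (use aV d in \<open>auto simp: a_def\<close>)
  moreover have "prod a I \<in> V" using aV by (rule subring_prod[OF val_subring])
  ultimately have hs: "h s \<in> val_ideal V" using val_unit_mult hV by blast
  \<comment> \<open>The inverse of a nonzero constant is again a constant, hence in V; so no nonzero
    constant lies in the maximal ideal.\<close>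
  have "s = 0"
  proof (rule ccontr)
    assume "s \<noteq> 0"
    then have "h (inverse s) * h s = 1"
      using chom_simps(1,3)[OF h(1)] by (metis left_inverse)
    then show False using val_ideal_mult[OF hV hs, of "inverse s"] val_ideal_one by simp
  qed
  then have d0: "\<forall>i\<in>I. d i = 0" using indep by (simp add: s_def)
  show ?thesis
  proof (intro ballI allI)
    fix i n assume i: "i \<in> I"
    \<comment> \<open>Order 0 says that the constant term 1/M_i of g_i is a unit, hence M_i \<in> V,
      and the division by M_i can be undone inside V.\<close>
    have "g i $ 0 \<notin> val_ideal V" using d(1)[OF i] d0 i by simp
    moreover have "g i $ 0 = inverse (M i)" using f0[OF i] by (simp add: g_def)
    ultimately have "inverse (inverse (M i)) \<in> V"
      using gV[OF i, of 0] val_ideal_iff_unit by metis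
    then have "M i * g i $ n \<in> V" using gV[OF i] by (intro cl) auto
    moreover have "M i * g i $ n = f i $ n" using m(1)[OF i] by (simp add: g_def M_def)
    ultimately show "f i $ n \<in> V" by simp
  qed
qed

end

section \<open>A field of generic functions\<close>

text \<open>A minimal proper filter decides every P: restricting it to P gives either the improper
  filter or the same filter again.\<close>

lemma ex_ultrafilter_le:
  fixes F :: "'a filter"
  assumes "F \<noteq> bot"
  shows "\<exists>U\<le>F. U \<noteq> bot \<and> (\<forall>P. eventually P U \<or> eventually (\<lambda>x. \<not> P x) U)"
proof -
  let ?A = "{G. G \<noteq> bot \<and> G \<le> F}"
  have "\<exists>U\<in>?A. \<forall>G\<in>?A. U \<ge> G \<longrightarrow> G = U"
  proof (rule predicate_Zorn)
    show "partial_order_on ?A (relation_of (\<ge>) ?A)"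
      by (rule partial_order_on_relation_ofI) auto
  next
    fix C assume C: "C \<in> Chains (relation_of (\<ge>) ?A)"
    have CA: "C \<subseteq> ?A" using C by (auto simp: Chains_def relation_of_def)
    have lin: "G \<le> H \<or> H \<le> G" if "G \<in> C" "H \<in> C" for G H
      using C that by (auto simp: Chains_def relation_of_def)
    show "\<exists>U\<in>?A. \<forall>G\<in>C. G \<ge> U"
    proof (cases "C = {}")
      case True
      then show ?thesis using assms by auto
    next
      case False
      have "eventually P (Inf C) \<longleftrightarrow> (\<exists>G\<in>C. eventually P G)" for P
        using False lin by (intro eventually_Inf_base) (metis inf.orderE inf_commute order_refl)+
      then have "Inf C \<noteq> bot" using CA by (auto simp: trivial_limit_def)
      moreover have "Inf C \<le> F" using False CA by (auto intro: Inf_lower2)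
      ultimately show ?thesis by (intro bexI[of _ "Inf C"]) (auto intro: Inf_lower)
    qed
  qed
  then obtain U where U: "U \<noteq> bot" "U \<le> F"
    and min: "\<And>G. G \<noteq> bot \<Longrightarrow> G \<le> U \<Longrightarrow> G = U"
    by (auto intro: order_trans)
  have "eventually P U \<or> eventually (\<lambda>x. \<not> P x) U" for P
  proof (cases "inf U (principal {x. P x}) = bot")
    case True
    then have "eventually (\<lambda>_. False) (inf U (principal {x. P x}))" by simp
    then show ?thesis by (simp add: eventually_inf_principal)
  next
    case False
    then have "inf U (principal {x. P x}) = U" using min by simp
    then have "U \<le> principal {x. P x}" by (metis inf.cobounded2)
    then show ?thesis by (auto simp: le_principal)
  qed
  then show ?thesis using U by blast
qed

text \<open>Validity on a dense open part of some neighbourhood of a;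
  \<open>S \<subseteq> closure V\<close> expresses that V is dense in the open set S.\<close>

definition generic_nhds :: "'a::topological_space \<Rightarrow> 'a filter" where
  "generic_nhds a = Abs_filter (\<lambda>P. \<exists>S V. open S \<and> a \<in> S \<and> open V \<and> S \<subseteq> closure V \<and> (\<forall>x\<in>S \<inter> V. P x))"

lemma dense_open_Int:
  fixes S :: "'a::topological_space set"
  assumes "open S" "open T" "open V" "open W" "S \<subseteq> closure V" "T \<subseteq> closure W"
  shows "S \<inter> T \<subseteq> closure (V \<inter> W)"
proof (rule ccontr)
  define X where "X = S \<inter> T - closure (V \<inter> W)"
  assume "\<not> S \<inter> T \<subseteq> closure (V \<inter> W)"
  then have "X \<inter> closure V \<noteq> {}" using assms by (auto simp: X_def)
  moreover have oX: "open X" using assms by (auto simp: X_def intro!: open_Diff)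
  ultimately have "X \<inter> V \<inter> closure W \<noteq> {}"
    using assms open_Int_closure_eq_empty[OF oX, of V] by (auto simp: X_def)
  then have "X \<inter> V \<inter> W \<noteq> {}"
    using oX assms open_Int_closure_eq_empty[of "X \<inter> V" W] by (auto simp: open_Int)
  then show False using closure_subset[of "V \<inter> W"] by (auto simp: X_def)
qed

lemma eventually_generic_nhds:
  "eventually P (generic_nhds a) \<longleftrightarrow>
     (\<exists>S V. open S \<and> a \<in> S \<and> open V \<and> S \<subseteq> closure V \<and> (\<forall>x\<in>S \<inter> V. P x))"
  unfolding generic_nhds_def
proof (rule eventually_Abs_filter, unfold is_filter_def, intro conjI allI impI)
  show "\<exists>S V. open S \<and> a \<in> S \<and> open V \<and> S \<subseteq> closure V \<and> (\<forall>x\<in>S \<inter> V. True)"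
    by (intro exI[of _ UNIV]) auto
next
  fix P Q
  assume "\<exists>S V. open S \<and> a \<in> S \<and> open V \<and> S \<subseteq> closure V \<and> (\<forall>x\<in>S \<inter> V. P x)"
    and "\<exists>S V. open S \<and> a \<in> S \<and> open V \<and> S \<subseteq> closure V \<and> (\<forall>x\<in>S \<inter> V. Q x)"
  then obtain S V T W where
    SV: "open S" "a \<in> S" "open V" "S \<subseteq> closure V" "\<forall>x\<in>S \<inter> V. P x" and
    TW: "open T" "a \<in> T" "open W" "T \<subseteq> closure W" "\<forall>x\<in>T \<inter> W. Q x" by blast
  have "S \<inter> T \<subseteq> closure (V \<inter> W)" using SV TW by (intro dense_open_Int)
  then show "\<exists>S V. open S \<and> a \<in> S \<and> open V \<and> S \<subseteq> closure V \<and> (\<forall>x\<in>S \<inter> V. P x \<and> Q x)"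
    using SV TW by (intro exI[of _ "S \<inter> T"] exI[of _ "V \<inter> W"]) auto
next
  fix P Q
  assume "\<forall>x. P x \<longrightarrow> Q x"
    and "\<exists>S V. open S \<and> a \<in> S \<and> open V \<and> S \<subseteq> closure V \<and> (\<forall>x\<in>S \<inter> V. P x)"
  then show "\<exists>S V. open S \<and> a \<in> S \<and> open V \<and> S \<subseteq> closure V \<and> (\<forall>x\<in>S \<inter> V. Q x)"
    by meson
qed

lemma generic_nhds_neq_bot: "generic_nhds a \<noteq> bot"
proof
  assume "generic_nhds a = bot"
  then have "eventually (\<lambda>_. False) (generic_nhds a)" by simp
  then obtain S V where "open S" "a \<in> S" "S \<subseteq> closure V" "S \<inter> V = {}"
    unfolding eventually_generic_nhds by blast
  then show False using open_Int_closure_eq_empty[of S V] by blast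
qed

definition generic_ultrafilter :: "'a::{topological_space,zero} filter" where
  "generic_ultrafilter = (SOME U. U \<le> generic_nhds 0 \<and> U \<noteq> bot \<and>
     (\<forall>P. eventually P U \<or> eventually (\<lambda>x. \<not> P x) U))"

lemma generic_ultrafilter:
  "generic_ultrafilter \<le> generic_nhds (0 :: 'a::{topological_space,zero})"
  "(generic_ultrafilter :: 'a filter) \<noteq> bot"
  "eventually P (generic_ultrafilter :: 'a filter) \<or> eventually (\<lambda>x. \<not> P x) (generic_ultrafilter :: 'a filter)"
  using someI_ex[OF ex_ultrafilter_le[OF generic_nhds_neq_bot[of "0::'a"], unfolded Bex_def]]
  unfolding generic_ultrafilter_def by blast+

definition generic_eq :: "('a::{topological_space,zero} \<Rightarrow> complex) \<Rightarrow> ('a \<Rightarrow> complex) \<Rightarrow> bool" where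
  "generic_eq f g \<longleftrightarrow> eventually (\<lambda>z. f z = g z) generic_ultrafilter"

text \<open>The ultrapower of \<open>\<complex>\<close> along \<^const>\<open>generic_ultrafilter\<close>. Since nowhere dense
  sets are negligible, germs of meromorphic functions at 0 embed into it; but every function has a
  class, so one can compute in this field without proving holomorphy first.\<close>

quotient_type (overloaded) 'a generic =
  "'a::{topological_space,zero} \<Rightarrow> complex" / "generic_eq"
proof (rule equivpI)
  show "reflp (generic_eq :: ('a \<Rightarrow> complex) \<Rightarrow> _)"
    by (auto simp: reflp_def generic_eq_def)
  show "symp (generic_eq :: ('a \<Rightarrow> complex) \<Rightarrow> _)"
    by (auto simp: symp_def generic_eq_def eq_commute)
  show "transp (generic_eq :: ('a \<Rightarrow> complex) \<Rightarrow> _)"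
    unfolding transp_def generic_eq_def by (auto elim: eventually_elim2)
qed

instantiation generic :: ("{topological_space,zero}") field
begin

lift_definition zero_generic :: "'a generic" is "\<lambda>_. 0" .
lift_definition one_generic :: "'a generic" is "\<lambda>_. 1" .
lift_definition plus_generic :: "'a generic \<Rightarrow> 'a generic \<Rightarrow> 'a generic" is "\<lambda>f g z. f z + g z"
  unfolding generic_eq_def by (auto elim: eventually_elim2)
lift_definition minus_generic :: "'a generic \<Rightarrow> 'a generic \<Rightarrow> 'a generic" is "\<lambda>f g z. f z - g z"
  unfolding generic_eq_def by (auto elim: eventually_elim2)
lift_definition times_generic :: "'a generic \<Rightarrow> 'a generic \<Rightarrow> 'a generic" is "\<lambda>f g z. f z * g z"
  unfolding generic_eq_def by (auto elim: eventually_elim2)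
lift_definition divide_generic :: "'a generic \<Rightarrow> 'a generic \<Rightarrow> 'a generic" is "\<lambda>f g z. f z / g z"
  unfolding generic_eq_def by (auto elim: eventually_elim2)
lift_definition uminus_generic :: "'a generic \<Rightarrow> 'a generic" is "\<lambda>f z. - f z"
  unfolding generic_eq_def by (auto elim: eventually_mono)
lift_definition inverse_generic :: "'a generic \<Rightarrow> 'a generic" is "\<lambda>f z. inverse (f z)"
  unfolding generic_eq_def by (auto elim: eventually_mono)

instance
proof
  fix a b c :: "'a generic"
  show "a * b * c = a * (b * c)" by transfer (simp add: generic_eq_def mult.assoc)
  show "a * b = b * a" by transfer (simp add: generic_eq_def mult.commute)
  show "1 * a = a" by transfer (simp add: generic_eq_def)
  show "a + b + c = a + (b + c)" by transfer (simp add: generic_eq_def add.assoc)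
  show "a + b = b + a" by transfer (simp add: generic_eq_def add.commute)
  show "0 + a = a" by transfer (simp add: generic_eq_def)
  show "- a + a = 0" by transfer (simp add: generic_eq_def)
  show "a - b = a + - b" by transfer (simp add: generic_eq_def)
  show "(a + b) * c = a * c + b * c" by transfer (simp add: generic_eq_def algebra_simps)
  show "(0::'a generic) \<noteq> 1"
    by transfer (simp add: generic_eq_def generic_ultrafilter(2))
  show "a div b = a * inverse b" by transfer (simp add: generic_eq_def field_simps)
  show "inverse (0::'a generic) = 0" by transfer (simp add: generic_eq_def)
  show "a \<noteq> 0 \<Longrightarrow> inverse a * a = 1"
  proof transfer
    fix f :: "'a \<Rightarrow> complex"
    assume "\<not> generic_eq f (\<lambda>_. 0)"
    then have "eventually (\<lambda>z. f z \<noteq> 0) generic_ultrafilter"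
      using generic_ultrafilter(3)[of "\<lambda>z. f z = 0"] by (auto simp: generic_eq_def)
    then show "generic_eq (\<lambda>z. inverse (f z) * f z) (\<lambda>_. 1)"
      unfolding generic_eq_def by (rule eventually_mono) simp
  qed
qed

end

lift_definition cls :: "('a::{topological_space,zero} \<Rightarrow> complex) \<Rightarrow> 'a generic" is "\<lambda>f. f" .

lemma cls_add: "cls (\<lambda>z. f z + g z) = cls f + cls g"
  by transfer (simp add: generic_eq_def)

lemma cls_mult: "cls (\<lambda>z. f z * g z) = cls f * cls g"
  by transfer (simp add: generic_eq_def)

lemma cls_one: "cls (\<lambda>_. 1) = 1"
  by transfer (simp add: generic_eq_def)

lemma cls_zero: "cls (\<lambda>_. 0) = 0"
  by transfer (simp add: generic_eq_def)

lemma cls_sum: "cls (\<lambda>z. \<Sum>i\<in>I. f i z) = (\<Sum>i\<in>I. cls (f i))"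
  by (induction I rule: infinite_finite_induct) (auto simp: cls_zero cls_add)

lemma cls_power: "cls (\<lambda>z. f z ^ n) = cls f ^ n"
  by (induction n) (auto simp: cls_one cls_mult)

lemma complex_hom_cls: "complex_hom (\<lambda>c. cls (\<lambda>_. c))"
  by (simp add: complex_hom_def cls_one cls_add[symmetric] cls_mult[symmetric])

lemma cls_eqI:
  assumes "open S" "0 \<in> S" "\<And>z. z \<in> S \<Longrightarrow> f z = g z"
  shows "cls f = cls g"
proof -
  have "eventually (\<lambda>z. f z = g z) (generic_nhds 0)"
    unfolding eventually_generic_nhds using assms
    by (intro exI[of _ S] exI[of _ UNIV]) auto
  then have "eventually (\<lambda>z. f z = g z) generic_ultrafilter"
    using generic_ultrafilter(1) by (auto simp: le_filter_def)
  then show ?thesis by transfer (simp add: generic_eq_def)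
qed

lemma cls_nonzeroI:
  fixes S :: "'a::{topological_space,zero} set"
  assumes "open S" "0 \<in> S" "open V" "S \<subseteq> closure V" "\<And>z. z \<in> S \<Longrightarrow> z \<in> V \<Longrightarrow> f z \<noteq> 0"
  shows "cls f \<noteq> 0"
proof
  assume "cls f = 0"
  then have ev: "eventually (\<lambda>z. f z = 0) generic_ultrafilter"
    by transfer (simp add: generic_eq_def)
  have "eventually (\<lambda>z. f z \<noteq> 0) (generic_nhds 0)"
    unfolding eventually_generic_nhds using assms by blast
  then have "eventually (\<lambda>z. f z \<noteq> 0) generic_ultrafilter"
    using generic_ultrafilter(1) by (auto simp: le_filter_def)
  with ev have "eventually (\<lambda>_. False) (generic_ultrafilter :: 'a filter)"
    by eventually_elim simp
  then show False using generic_ultrafilter(2)[where 'a = 'a] by simp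
qed

text \<open>A family of series in t, indexed by z, read as one series over the ultrapower. This
  respects ring operations and derivatives because each resulting coefficient involves only finitely
  many given ones.\<close>

definition cls_fps :: "('a::{topological_space,zero} \<Rightarrow> complex fps) \<Rightarrow> 'a generic fps" where
  "cls_fps g = Abs_fps (\<lambda>n. cls (\<lambda>z. fps_nth (g z) n))"

lemma cls_fps_nth [simp]: "fps_nth (cls_fps g) n = cls (\<lambda>z. fps_nth (g z) n)"
  by (simp add: cls_fps_def)

lemma cls_fps_add: "cls_fps (\<lambda>z. f z + g z) = cls_fps f + cls_fps g"
  by (rule fps_ext) (simp add: cls_add)

lemma cls_fps_mult: "cls_fps (\<lambda>z. f z * g z) = cls_fps f * cls_fps g"
  by (rule fps_ext) (simp add: fps_mult_nth cls_sum cls_mult)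

lemma cls_fps_const: "cls_fps (\<lambda>z. fps_const (c z)) = fps_const (cls c)"
  by (rule fps_ext) (simp add: cls_zero)

lemma cls_fps_X: "cls_fps (\<lambda>_. fps_X) = fps_X"
  by (rule fps_ext) (simp add: cls_zero cls_one fps_X_def)

lemma cls_fps_one: "cls_fps (\<lambda>_. 1) = 1"
  using cls_fps_const[of "\<lambda>_. 1"] by (simp add: cls_one)

lemma cls_fps_zero: "cls_fps (\<lambda>_. 0) = 0"
  using cls_fps_const[of "\<lambda>_. 0"] by (simp add: cls_zero)

lemma cls_fps_deriv: "cls_fps (\<lambda>z. fps_deriv (f z)) = fps_deriv (cls_fps f)"
proof (rule fps_ext)
  fix n
  have "cls (\<lambda>_::'a. of_nat (Suc n)) = of_nat (Suc n)"
    by (rule chom_of_nat[OF complex_hom_cls])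
  then show "fps_nth (cls_fps (\<lambda>z. fps_deriv (f z))) n = fps_nth (fps_deriv (cls_fps f)) n"
    by (simp add: cls_mult del: of_nat_Suc)
qed

lemma cls_fps_sum: "cls_fps (\<lambda>z. \<Sum>i\<in>I. f i z) = (\<Sum>i\<in>I. cls_fps (f i))"
  by (induction I rule: infinite_finite_induct) (auto simp: cls_fps_zero cls_fps_add)

lemma cls_fps_prod: "cls_fps (\<lambda>z. \<Prod>i\<in>I. f i z) = (\<Prod>i\<in>I. cls_fps (f i))"
  by (induction I rule: infinite_finite_induct) (auto simp: cls_fps_one cls_fps_mult)

lemma cls_fps_power: "cls_fps (\<lambda>z. f z ^ n) = cls_fps f ^ n"
  by (induction n) (auto simp: cls_fps_one cls_fps_mult)

lemma cls_fps_eqI: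
  assumes "open S" "0 \<in> S" "\<And>z. z \<in> S \<Longrightarrow> f z = g z"
  shows "cls_fps f = cls_fps g"
  by (rule fps_ext) (use assms in \<open>auto intro: cls_eqI\<close>)

section \<open>Holomorphic functions along curves\<close>

unbundle vec_syntax
unbundle no Formal_Power_Series.fps_syntax

lemma holo_onD:
  assumes "holo_on S f" "z \<in> S"
  obtains L where "(f has_derivative L) (at z)" "\<And>h. L (\<i> *s h) = \<i> * L h"
  using assms unfolding holo_on_def by blast

lemma holo_on_const: "holo_on S (\<lambda>_. c)"
  unfolding holo_on_def by (auto intro!: exI[of _ "\<lambda>_. 0"] derivative_eq_intros)

lemma holo_on_nth: "holo_on S (\<lambda>z :: complex^'n. z $ i)"
  unfolding holo_on_def
  by (auto intro!: exI[of _ "\<lambda>h. h $ i"] bounded_linear_imp_has_derivative bounded_linear_vec_nth)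

lemma holo_on_add:
  assumes "holo_on S f" "holo_on S g"
  shows "holo_on S (\<lambda>z. f z + g z)"
  unfolding holo_on_def
proof
  fix z assume z: "z \<in> S"
  obtain L M where "(f has_derivative L) (at z)" "\<And>h. L (\<i> *s h) = \<i> * L h"
    "(g has_derivative M) (at z)" "\<And>h. M (\<i> *s h) = \<i> * M h"
    using holo_onD[OF assms(1) z] holo_onD[OF assms(2) z] by metis
  then show "\<exists>L. ((\<lambda>z. f z + g z) has_derivative L) (at z) \<and> (\<forall>h. L (\<i> *s h) = \<i> * L h)"
    by (intro exI[of _ "\<lambda>h. L h + M h"]) (auto intro!: has_derivative_add simp: algebra_simps)
qed

lemma holo_on_mult:
  assumes "holo_on S f" "holo_on S g"
  shows "holo_on S (\<lambda>z. f z * g z)"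
  unfolding holo_on_def
proof
  fix z assume z: "z \<in> S"
  obtain L M where "(f has_derivative L) (at z)" "\<And>h. L (\<i> *s h) = \<i> * L h"
    "(g has_derivative M) (at z)" "\<And>h. M (\<i> *s h) = \<i> * M h"
    using holo_onD[OF assms(1) z] holo_onD[OF assms(2) z] by metis
  moreover from this have "((\<lambda>z. f z * g z) has_derivative (\<lambda>h. f z * M h + L h * g z)) (at z)"
    by (blast intro: has_derivative_mult)
  moreover from calculation
  have "f z * M (\<i> *s h) + L (\<i> *s h) * g z = \<i> * (f z * M h + L h * g z)" for h
    by (simp only: distrib_left mult_ac)
  ultimately show "\<exists>L. ((\<lambda>z. f z * g z) has_derivative L) (at z) \<and> (\<forall>h. L (\<i> *s h) = \<i> * L h)"
    by blast
qed

lemma holo_on_power: "holo_on S f \<Longrightarrow> holo_on S (\<lambda>z. f z ^ n)"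
  by (induction n) (auto intro: holo_on_const holo_on_mult)

lemma holo_on_sum: "(\<And>i. i \<in> I \<Longrightarrow> holo_on S (f i)) \<Longrightarrow> holo_on S (\<lambda>z. \<Sum>i\<in>I. f i z)"
  by (induction I rule: infinite_finite_induct) (auto intro: holo_on_const holo_on_add)

lemma holo_on_prod: "(\<And>i. i \<in> I \<Longrightarrow> holo_on S (f i)) \<Longrightarrow> holo_on S (\<lambda>z. \<Prod>i\<in>I. f i z)"
  by (induction I rule: infinite_finite_induct) (auto intro: holo_on_const holo_on_mult)

lemma holo_on_monom: "holo_on S (\<lambda>z :: complex^'n. Defs.monom \<alpha> (($) z))"
  unfolding monom_def by (intro holo_on_prod holo_on_power holo_on_nth)

lemma holo_on_imp_continuous_on: "holo_on S f \<Longrightarrow> continuous_on S f"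
  by (rule continuous_at_imp_continuous_on) (meson holo_onD has_derivative_continuous)

lemma has_derivative_vec_components:
  fixes \<gamma> :: "complex \<Rightarrow> complex^'n"
  assumes "\<And>i. ((\<lambda>t. \<gamma> t $ i) has_field_derivative d $ i) (at t)"
  shows "(\<gamma> has_derivative (\<lambda>s. s *s d)) (at t)"
proof -
  have bl: "bounded_linear (axis i :: complex \<Rightarrow> complex^'n)" for i
    by (subst linear_conv_bounded_linear[symmetric])
      (auto intro!: linearI simp: vec_eq_iff axis_def)
  have decomp: "v = (\<Sum>i\<in>UNIV. axis i (v $ i))" for v :: "complex^'n"
    by (simp add: vec_eq_iff axis_def sum.delta)
  have "((\<lambda>s. \<Sum>i\<in>UNIV. axis i (\<gamma> s $ i)) has_derivative
      (\<lambda>s. \<Sum>i\<in>UNIV. axis i (d $ i * s))) (at t)"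
    using assms
    by (intro has_derivative_sum bounded_linear.has_derivative[OF bl])
      (auto simp: has_field_derivative_def)
  moreover have "(\<Sum>i\<in>UNIV. axis i (d $ i * s)) = s *s d" for s
    using decomp[of "s *s d"] by (simp add: mult.commute)
  ultimately show ?thesis using decomp by simp
qed

lemma complex_linear_scale:
  assumes L: "linear L" and i: "\<And>h. L (\<i> *s h) = \<i> * L (h :: complex^'n)"
  shows "L (s *s h) = s * (L h :: complex)"
proof -
  have "s *s h = Re s *\<^sub>R h + Im s *\<^sub>R (\<i> *s h)"
    by (simp add: vec_eq_iff complex_eq_iff algebra_simps)
  then have "L (s *s h) = Re s *\<^sub>R L h + Im s *\<^sub>R (\<i> * L h)"
    by (simp add: linear_add[OF L] linear_scale[OF L] i)
  also have "\<dots> = s * L h" by (simp add: complex_eq_iff algebra_simps)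
  finally show ?thesis .
qed

lemma holo_on_compose_curve:
  fixes f :: "complex^'n \<Rightarrow> complex"
  assumes f: "holo_on S f" and T: "open T" and \<gamma>: "\<And>t. t \<in> T \<Longrightarrow> \<gamma> t \<in> S"
    and d: "\<And>t i. t \<in> T \<Longrightarrow> (\<lambda>t. \<gamma> t $ i) field_differentiable (at t)"
  shows "(\<lambda>t. f (\<gamma> t)) holomorphic_on T"
proof -
  have "(\<lambda>t. f (\<gamma> t)) field_differentiable (at t)" if t: "t \<in> T" for t
  proof -
    obtain L where L: "(f has_derivative L) (at (\<gamma> t))" "\<And>h. L (\<i> *s h) = \<i> * L h"
      using holo_onD[OF f \<gamma>[OF t]] by metis
    define d' where "d' = (\<chi> i. deriv (\<lambda>t. \<gamma> t $ i) t)"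
    have "(\<gamma> has_derivative (\<lambda>s. s *s d')) (at t)"
      using d[OF t] by (intro has_derivative_vec_components) (simp add: d'_def DERIV_deriv_iff_field_differentiable)
    then have "((\<lambda>t. f (\<gamma> t)) has_derivative (\<lambda>s. L (s *s d'))) (at t)"
      using L(1) by (rule has_derivative_compose)
    moreover have "L (s *s d') = L d' * s" for s
      using complex_linear_scale[OF has_derivative_linear[OF L(1)] L(2)] by (simp add: mult.commute)
    ultimately have "((\<lambda>t. f (\<gamma> t)) has_field_derivative L d') (at t)"
      by (simp add: has_field_derivative_def)
    then show ?thesis by (auto simp: field_differentiable_def)
  qed
  then show ?thesis using T by (simp add: holomorphic_on_open field_differentiable_def)
qed

text \<open>Identity theorem in several variables, by restriction to the complex line through w and
  z: its parameters in the ball form a convex open set, and f would vanish near w, hence also at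
  z.\<close>

lemma holo_on_ball_nonzero_dense:
  fixes f :: "complex^'n \<Rightarrow> complex"
  assumes f: "holo_on (ball 0 r) f" and z: "z \<in> ball 0 r" "f z \<noteq> 0"
  shows "ball 0 r \<subseteq> closure {w \<in> ball 0 r. f w \<noteq> 0}"
proof
  fix w :: "complex^'n" assume w: "w \<in> ball 0 r"
  show "w \<in> closure {w \<in> ball 0 r. f w \<noteq> 0}"
  proof (rule ccontr)
    assume nw: "w \<notin> closure {w \<in> ball 0 r. f w \<noteq> 0}"
    define \<gamma> where "\<gamma> s = w + s *s (z - w)" for s
    define T where "T = \<gamma> -` ball 0 r"
    define T0 where "T0 = \<gamma> -` (ball 0 r - closure {w \<in> ball 0 r. f w \<noteq> 0})"
    have c\<gamma>: "continuous_on UNIV \<gamma>"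
      unfolding \<gamma>_def vector_scalar_mult_def by (intro continuous_intros)
    have oT: "open T" unfolding T_def by (intro open_vimage c\<gamma>) auto
    have oT0: "open T0" unfolding T0_def by (intro open_vimage c\<gamma>) (auto intro: open_Diff)
    have conv: "\<gamma> ((1 - u) *\<^sub>R a + u *\<^sub>R b) = (1 - u) *\<^sub>R \<gamma> a + u *\<^sub>R \<gamma> b" for u a b
      by (simp add: \<gamma>_def vec_eq_iff) (simp add: scaleR_conv_of_real algebra_simps)
    have "convex T"
      unfolding convex_alt T_def using convex_ball[of "0::complex^'n" r]
      by (auto simp: conv convex_alt simp del: mem_ball)
    then have cT: "connected T" by (rule convex_connected)
    have hol: "(\<lambda>s. f (\<gamma> s)) holomorphic_on T"
      by (rule holo_on_compose_curve[OF f oT])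
        (auto simp: T_def \<gamma>_def intro!: derivative_intros field_differentiable_mult)
    have "f (\<gamma> 1) = 0"
    proof (rule analytic_continuation[OF hol oT cT, of T0 0])
      show "0 \<in> T" "1 \<in> T" using w z by (auto simp: T_def \<gamma>_def)
      have "0 \<in> T0" using w nw by (auto simp: T0_def \<gamma>_def)
      then show "0 islimpt T0" using oT0 by (simp add: interior_limit_point interior_open)
      show "T0 \<subseteq> T" by (auto simp: T_def T0_def)
      show "f (\<gamma> s) = 0" if "s \<in> T0" for s
        using that closure_subset[of "{w \<in> ball 0 r. f w \<noteq> 0}"] unfolding T0_def by blast
    qed
    then show False using z by (simp add: \<gamma>_def)
  qed
qed

text \<open>The way back from the ultrapower to functions: a holomorphic function whose class is 0
  vanishes on the entire ball.\<close>

lemma cls_holo_nonzero: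
  fixes f :: "complex^'n \<Rightarrow> complex"
  assumes f: "holo_on (ball 0 r) f" and z: "z \<in> ball 0 r" "f z \<noteq> 0"
  shows "cls f \<noteq> 0"
proof (rule cls_nonzeroI)
  show "ball 0 r \<subseteq> closure {w \<in> ball 0 r. f w \<noteq> 0}"
    by (rule holo_on_ball_nonzero_dense[OF assms])
  show "open {w \<in> ball 0 r. f w \<noteq> 0}"
    using continuous_open_preimage[OF holo_on_imp_continuous_on[OF f] open_ball, of "- {0}"]
    by (auto simp: vimage_def Int_def intro: open_Compl)
  have "norm z < r" using z by simp
  then have "0 < r" by (rule order.strict_trans1[OF norm_ge_zero])
  then show "0 \<in> ball (0::complex^'n) r" by simp
qed auto

section \<open>Monomial curves and the independence of monomials\<close>

lemma digits_unique:
  fixes a b :: "nat \<Rightarrow> nat"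
  assumes "\<And>i. i < k \<Longrightarrow> a i < M" "\<And>i. i < k \<Longrightarrow> b i < M"
    and "(\<Sum>i<k. M ^ i * a i) = (\<Sum>i<k. M ^ i * b i)"
  shows "\<forall>i<k. a i = b i"
  using assms
proof (induction k arbitrary: a b)
  case (Suc k)
  have split: "(\<Sum>i<Suc k. M ^ i * c i) = c 0 + M * (\<Sum>i<k. M ^ i * c (Suc i))" for c :: "nat \<Rightarrow> nat"
    unfolding sum.lessThan_Suc_shift by (simp add: sum_distrib_left mult.assoc)
  have eq: "a 0 + M * (\<Sum>i<k. M ^ i * a (Suc i)) = b 0 + M * (\<Sum>i<k. M ^ i * b (Suc i))"
    using Suc.prems(3) unfolding split .
  have lt: "a 0 < M" "b 0 < M" using Suc.prems by auto
  have "a 0 = b 0" using arg_cong[OF eq, of "\<lambda>x. x mod M"] lt by simp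
  moreover from this have "(\<Sum>i<k. M ^ i * a (Suc i)) = (\<Sum>i<k. M ^ i * b (Suc i))"
    using eq lt by auto
  then have "\<forall>i<k. a (Suc i) = b (Suc i)" using Suc.prems by (intro Suc.IH) auto
  ultimately show ?case by (auto simp: less_Suc_eq_0_disj)
qed auto

text \<open>Kronecker substitution: weighted degrees separate finitely many multi-indices.\<close>

lemma ex_separating_weights:
  fixes A :: "('n::finite \<Rightarrow> nat) set"
  assumes "finite A"
  shows "\<exists>e. (\<forall>i. 0 < e i) \<and> inj_on (\<lambda>\<alpha>. \<Sum>i\<in>UNIV. e i * \<alpha> i) A"
proof -
  obtain ix :: "'n \<Rightarrow> nat" where ix: "bij_betw ix UNIV {..<CARD('n)}"
    using ex_bij_betw_finite_nat[of "UNIV :: 'n set"] by (auto simp: atLeast0LessThan)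
  \<comment> \<open>M exceeds all entries of all multi-indices in A, so they can be read as digits
    in base M. The \<open>Suc\<close> keeps M, and with it every weight, positive.\<close>
  define M where "M = Suc (\<Sum>\<alpha>\<in>A. \<Sum>i\<in>UNIV. \<alpha> i)"
  have M: "\<alpha> i < M" if "\<alpha> \<in> A" for \<alpha> i
  proof -
    have "\<alpha> i \<le> (\<Sum>i\<in>UNIV. \<alpha> i)" by (intro member_le_sum) auto
    also have "\<dots> \<le> (\<Sum>\<alpha>\<in>A. \<Sum>i\<in>UNIV. \<alpha> i)" using that assms by (intro member_le_sum) auto
    finally show ?thesis by (simp add: M_def)
  qed
  define e where "e i = M ^ ix i" for i
  define inv where "inv = the_inv_into UNIV ix"
  have inv: "inv (ix i) = i" for i
    unfolding inv_def using ix by (intro the_inv_into_f_f) (auto simp: bij_betw_def)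
  have conv: "(\<Sum>i\<in>UNIV. e i * \<alpha> i) = (\<Sum>j<CARD('n). M ^ j * \<alpha> (inv j))" for \<alpha> :: "'n \<Rightarrow> nat"
    using sum.reindex_bij_betw[OF ix, of "\<lambda>j. M ^ j * \<alpha> (inv j)"] by (simp add: e_def inv)
  have "inj_on (\<lambda>\<alpha>. \<Sum>i\<in>UNIV. e i * \<alpha> i) A"
  proof (rule inj_onI)
    fix \<alpha> \<beta> assume "\<alpha> \<in> A" "\<beta> \<in> A" "(\<Sum>i\<in>UNIV. e i * \<alpha> i) = (\<Sum>i\<in>UNIV. e i * \<beta> i)"
    then have "\<forall>j<CARD('n). \<alpha> (inv j) = \<beta> (inv j)"
      unfolding conv by (intro digits_unique[where M = M]) (auto intro: M)
    then have "\<alpha> (inv (ix i)) = \<beta> (inv (ix i))" for i using ix by (auto simp: bij_betw_def)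
    then show "\<alpha> = \<beta>" by (auto simp: inv)
  qed
  moreover have "0 < e i" for i by (simp add: e_def M_def)
  ultimately show ?thesis by blast
qed

text \<open>For positive weights this joins 0 at t = 0 to \<eta> at t = 1, and it turns a monomial
  in \<xi> into a constant times a single power of t.\<close>

definition kcurve :: "('n \<Rightarrow> nat) \<Rightarrow> complex^'n \<Rightarrow> complex \<Rightarrow> complex^'n" where
  "kcurve e \<eta> t = (\<chi> i. \<eta> $ i * t ^ e i)"

lemma monom_kcurve:
  "Defs.monom \<alpha> (($) (kcurve e \<eta> t)) = Defs.monom \<alpha> (($) \<eta>) * t ^ (\<Sum>i\<in>UNIV. e i * \<alpha> i)"
  by (simp add: monom_def kcurve_def power_mult_distrib prod.distrib power_sum power_mult)

lemma norm_kcurve_le: "norm t \<le> 1 \<Longrightarrow> norm (kcurve e \<eta> t) \<le> norm \<eta>"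
  unfolding norm_vec_def
  by (rule L2_set_mono) (auto simp: kcurve_def norm_mult norm_power power_le_one mult_left_le)

lemma kcurve_mult: "kcurve e \<eta> (s * t) = kcurve e (kcurve e \<eta> t) s"
  by (simp add: kcurve_def vec_eq_iff power_mult_distrib mult_ac)

text \<open>Shrinking t towards 0 shrinks every coordinate, so the domain is star-shaped about 0.
  Vanishing near t = 0 therefore propagates to t = 1, that is, to the point \<eta>.\<close>

lemma kcurve_domain:
  fixes \<eta> :: "complex^'n"
  assumes e: "\<And>i. 0 < e i" and \<eta>: "\<eta> \<in> ball 0 r"
  defines "T \<equiv> {t. kcurve e \<eta> t \<in> ball 0 r}"
  shows "open T" "connected T" "0 \<in> T" "1 \<in> T" "kcurve e \<eta> 0 = 0" "kcurve e \<eta> 1 = \<eta>"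
proof -
  show k0: "kcurve e \<eta> 0 = 0" "kcurve e \<eta> 1 = \<eta>"
    using e by (auto simp: kcurve_def vec_eq_iff)
  have "norm \<eta> < r" using \<eta> by simp
  then have "0 < r" by (rule order.strict_trans1[OF norm_ge_zero])
  then show T01: "0 \<in> T" "1 \<in> T" using \<eta> by (auto simp: T_def k0)
  have "continuous_on UNIV (kcurve e \<eta>)"
    unfolding kcurve_def by (intro continuous_intros)
  from open_vimage[OF open_ball this, of 0 r] show "open T" unfolding T_def vimage_def .
  have "closed_segment 0 t \<subseteq> T" if "t \<in> T" for t
  proof
    fix x assume "x \<in> closed_segment 0 t"
    then obtain u where u: "0 \<le> u" "u \<le> 1" "x = of_real u * t"
      by (auto simp: closed_segment_def scaleR_conv_of_real)
    have "norm (kcurve e \<eta> x) \<le> norm (kcurve e \<eta> t)"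
      unfolding u kcurve_mult using u by (intro norm_kcurve_le) auto
    then show "x \<in> T" using that by (auto simp: T_def)
  qed
  then have "starlike T" using T01 by (auto simp: starlike_def)
  then show "connected T" by (rule starlike_imp_connected)
qed

text \<open>Along a curve with separating weights the monomials become distinct powers of t, and a
  polynomial in t with infinitely many roots is zero.\<close>

lemma monom_independent:
  fixes p :: "('n::finite \<Rightarrow> nat) \<Rightarrow> complex"
  assumes A: "finite A" and r: "r > 0"
    and z: "\<And>z :: complex^'n. z \<in> ball 0 r \<Longrightarrow> (\<Sum>\<alpha>\<in>A. p \<alpha> * Defs.monom \<alpha> (($) z)) = 0"
    and \<alpha>: "\<alpha> \<in> A"
  shows "p \<alpha> = 0"
proof -
  obtain e where e: "\<And>i. 0 < e i" "inj_on (\<lambda>\<alpha>. \<Sum>i\<in>UNIV. e i * \<alpha> i) A"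
    using ex_separating_weights[OF A] by blast
  define wt where "wt \<alpha> = (\<Sum>i\<in>UNIV. e i * \<alpha> i)" for \<alpha>
  \<comment> \<open>Bounding the norm by the sum of the moduli of the coordinates gives at most r/2
    for the diagonal point, whose coordinates are all nonzero.\<close>
  define \<delta> where "\<delta> = r / (2 * (real CARD('n)))"
  have \<delta>: "\<delta> > 0" using r by (simp add: \<delta>_def)
  define \<eta> :: "complex^'n" where "\<eta> = (\<chi> i. of_real \<delta>)"
  have "norm \<eta> \<le> (\<Sum>i\<in>UNIV. norm (\<eta> $ i))"
    unfolding norm_vec_def by (rule L2_set_le_sum) simp
  also have "\<dots> = r / 2" using \<delta> by (simp add: \<eta>_def) (simp add: \<delta>_def)
  finally have n\<eta>: "norm \<eta> < r" using r by simp
  define Q where "Q = (\<Sum>\<beta>\<in>A. Polynomial.monom (p \<beta> * Defs.monom \<beta> (($) \<eta>)) (wt \<beta>))"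
  have "poly Q t = 0" if "t \<in> cball 0 1" for t
  proof -
    have "kcurve e \<eta> t \<in> ball 0 r" using norm_kcurve_le[of t e \<eta>] n\<eta> that by auto
    from z[OF this] show ?thesis
      by (simp add: Q_def poly_sum poly_monom monom_kcurve wt_def mult_ac)
  qed
  then have "cball 0 1 \<subseteq> {t. poly Q t = 0}" by auto
  moreover have "infinite (cball (0::complex) 1)"
    using uncountable_cball[of 1 "0::complex"] countable_finite by auto
  ultimately have "Q = 0" using poly_roots_finite finite_subset by blast
  then have "0 = coeff Q (wt \<alpha>)" by simp
  also have "\<dots> = (\<Sum>\<beta>\<in>A. if \<beta> = \<alpha> then p \<beta> * Defs.monom \<beta> (($) \<eta>) else 0)"
    unfolding Q_def coeff_sum coeff_monom using e(2) \<alpha>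
    by (intro sum.cong) (auto simp: wt_def inj_on_def)
  also have "\<dots> = p \<alpha> * Defs.monom \<alpha> (($) \<eta>)" using A \<alpha> by simp
  finally show ?thesis using \<delta> by (auto simp: monom_def \<eta>_def)
qed

section \<open>Logarithmic derivatives of products of powers\<close>

text \<open>The last equation is W'/W = c U'/U without denominators, for W the expansion of
  u^c.\<close>

lemma powr_const_fps_relation:
  fixes u :: "complex \<Rightarrow> complex"
  assumes u: "u has_fps_expansion U" "u 0 = 1"
  shows "\<exists>W. (\<lambda>t. u t powr c) has_fps_expansion W \<and> fps_nth W 0 = 1 \<and>
    fps_deriv W * U = fps_const c * fps_deriv U * W"
proof -
  have au: "u analytic_on {0}" using u(1) by (rule has_fps_expansion_imp_analytic_0)
  then obtain s where s: "0 < s" "u holomorphic_on ball 0 s"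
    by (auto simp: analytic_on_def)
  have "open (ball 0 s \<inter> u -` ball 1 1)"
    using continuous_open_preimage[OF holomorphic_on_imp_continuous_on[OF s(2)] open_ball open_ball] .
  moreover have "0 \<in> ball 0 s \<inter> u -` ball 1 1" using s u(2) by simp
  ultimately obtain \<delta> where \<delta>: "0 < \<delta>" "ball 0 \<delta> \<subseteq> ball 0 s \<inter> u -` ball 1 1"
    by (rule openE)
  define w where "w t = u t powr c" for t
  \<comment> \<open>Points at distance less than 1 from 1 have positive real part and avoid the
    branch cut of the principal power.\<close>
  have npos: "u t \<notin> \<real>\<^sub>\<le>\<^sub>0" if "t \<in> ball 0 \<delta>" for t
  proof
    assume "u t \<in> \<real>\<^sub>\<le>\<^sub>0"
    then have "Re (u t) \<le> 0" by (auto elim: nonpos_Reals_cases)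
    then have "1 \<le> \<bar>Re (1 - u t)\<bar>" by simp
    also have "\<dots> \<le> norm (1 - u t)" by (rule abs_Re_le_cmod)
    also have "\<dots> < 1" using that \<delta>(2) by (auto simp: dist_norm)
    finally show False by simp
  qed
  have dw: "(w has_field_derivative c * deriv u t * w t / u t) (at t)" if t: "t \<in> ball 0 \<delta>" for t
  proof -
    have u0: "u t \<noteq> 0" using npos[OF t] by auto
    have "(u has_field_derivative deriv u t) (at t)"
      using s(2) t \<delta>(2) by (intro holomorphic_derivI[of _ "ball 0 s"]) auto
    then have "((\<lambda>t. exp (c * Ln (u t))) has_field_derivative
        exp (c * Ln (u t)) * (c * (inverse (u t) * deriv u t))) (at t)"
      using npos[OF t] by (auto intro!: derivative_eq_intros)
    then have "((\<lambda>t. exp (c * Ln (u t))) has_field_derivative c * deriv u t * w t / u t) (at t)"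
      using u0 by (simp add: w_def powr_def field_simps)
    then show ?thesis
      by (rule has_field_derivative_transform_within_open[of _ _ _ "ball 0 \<delta>"])
        (use t npos in \<open>force simp: w_def powr_def\<close>)+
  qed
  have "w holomorphic_on ball 0 \<delta>"
    unfolding holomorphic_on_open[OF open_ball] using dw by blast
  then have aw: "w analytic_on {0}" using \<delta> by (auto simp: analytic_on_def)
  define W where "W = fps_expansion w 0"
  have W: "w has_fps_expansion W"
    unfolding W_def by (rule analytic_at_imp_has_fps_expansion_0[OF aw])
  have "fps_nth W 0 = w 0" using W by (simp add: has_fps_expansion_imp_0_eq_fps_nth_0)
  then have W0: "fps_nth W 0 = 1" by (simp add: w_def u(2))
  have 1: "(\<lambda>t. deriv w t * u t) has_fps_expansion fps_deriv W * U"
    by (intro fps_expansion_intros W u)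
  have 2: "(\<lambda>t. c * deriv u t * w t) has_fps_expansion fps_const c * fps_deriv U * W"
    by (intro fps_expansion_intros W u)
  have "eventually (\<lambda>t. t \<in> ball 0 \<delta>) (nhds 0)"
    using \<delta> by (intro eventually_nhds_in_open) auto
  then have "eventually (\<lambda>t. deriv w t * u t = c * deriv u t * w t) (nhds 0)"
  proof eventually_elim
    case (elim t)
    have "u t \<noteq> 0" using npos[OF elim] by auto
    then show ?case using DERIV_imp_deriv[OF dw[OF elim]] by simp
  qed
  then have "(\<lambda>t. c * deriv u t * w t) has_fps_expansion fps_deriv W * U"
    using 1 has_fps_expansion_cong[OF _ refl] by fast
  then have "fps_deriv W * U = fps_const c * fps_deriv U * W"
    using 2 fps_expansion_unique_complex by blast
  then show ?thesis using W W0 unfolding w_def by blast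
qed

lemma fps_deriv_prod:
  fixes f :: "'i \<Rightarrow> 'a::comm_ring_1 fps"
  shows "finite I \<Longrightarrow> fps_deriv (prod f I) = (\<Sum>i\<in>I. fps_deriv (f i) * prod f (I - {i}))"
proof (induction I rule: finite_induct)
  case (insert i I)
  have "(\<Sum>j\<in>I. fps_deriv (f j) * prod f (insert i I - {j})) =
      (\<Sum>j\<in>I. f i * (fps_deriv (f j) * prod f (I - {j})))"
  proof (rule sum.cong[OF refl])
    fix j assume "j \<in> I"
    then have "insert i I - {j} = insert i (I - {j})" "i \<notin> I - {j}" using insert by auto
    then show "fps_deriv (f j) * prod f (insert i I - {j}) = f i * (fps_deriv (f j) * prod f (I - {j}))"
      using insert(1) by (simp add: mult_ac)
  qed
  then show ?case using insert by (simp add: sum_distrib_left)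
qed simp

text \<open>The identity sum c_i U_i'/U_i = W'/W, multiplied by W and by all the U_i.\<close>

lemma log_deriv_prod_powr:
  fixes u :: "'i \<Rightarrow> complex \<Rightarrow> complex"
  assumes I: "finite I"
    and u: "\<And>i. i \<in> I \<Longrightarrow> u i has_fps_expansion U i" "\<And>i. i \<in> I \<Longrightarrow> u i 0 = 1"
  shows "\<exists>W. (\<lambda>t. \<Prod>i\<in>I. u i t powr c i) has_fps_expansion W \<and> fps_nth W 0 = 1 \<and>
    (\<Sum>i\<in>I. fps_const (c i) * fps_deriv (U i) * (\<Prod>j\<in>I - {i}. U j)) * W = fps_deriv W * (\<Prod>i\<in>I. U i)"
proof -
  have "\<exists>W. (\<lambda>t. u i t powr c i) has_fps_expansion W \<and> fps_nth W 0 = 1 \<and>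
    fps_deriv W * U i = fps_const (c i) * fps_deriv (U i) * W" if "i \<in> I" for i
    using powr_const_fps_relation[OF u[OF that]] .
  then obtain W where W: "\<And>i. i \<in> I \<Longrightarrow> (\<lambda>t. u i t powr c i) has_fps_expansion W i"
    "\<And>i. i \<in> I \<Longrightarrow> fps_nth (W i) 0 = 1"
    "\<And>i. i \<in> I \<Longrightarrow> fps_deriv (W i) * U i = fps_const (c i) * fps_deriv (U i) * W i"
    by metis
  have "(\<lambda>t. \<Prod>i\<in>I. u i t powr c i) has_fps_expansion prod W I"
    by (intro has_fps_expansion_prod W)
  moreover have "fps_nth (prod W I) 0 = 1"
    using I W(2) by (induction I rule: finite_induct) auto
  moreover have "(\<Sum>i\<in>I. fps_const (c i) * fps_deriv (U i) * (\<Prod>j\<in>I - {i}. U j)) * prod W I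
      = fps_deriv (prod W I) * prod U I"
  proof -
    have "fps_deriv (prod W I) * prod U I = (\<Sum>i\<in>I. fps_deriv (W i) * prod W (I - {i}) * prod U I)"
      by (simp only: fps_deriv_prod[OF I] sum_distrib_right)
    also have "\<dots> = (\<Sum>i\<in>I. fps_const (c i) * fps_deriv (U i) * (\<Prod>j\<in>I - {i}. U j) * prod W I)"
    proof (rule sum.cong[OF refl])
      fix i assume i: "i \<in> I"
      have "prod U I = U i * prod U (I - {i})" "prod W I = W i * prod W (I - {i})"
        using I i by (auto intro: prod.remove)
      then have "fps_deriv (W i) * prod W (I - {i}) * prod U I
        = (fps_deriv (W i) * U i) * (prod W (I - {i}) * prod U (I - {i}))"
        by (simp only: mult_ac)
      also have "\<dots> = fps_const (c i) * fps_deriv (U i) * prod U (I - {i}) * (W i * prod W (I - {i}))"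
        unfolding W(3)[OF i] by (simp only: mult_ac)
      finally show "fps_deriv (W i) * prod W (I - {i}) * prod U I
        = fps_const (c i) * fps_deriv (U i) * (\<Prod>j\<in>I - {i}. U j) * prod W I"
        using \<open>prod W I = _\<close> by simp
    qed
    finally show ?thesis by (simp only: sum_distrib_right)
  qed
  ultimately show ?thesis by blast
qed

section \<open>Algebraic classes\<close>

definition poly_cls :: "(complex^'n) generic set" where
  "poly_cls = {cls (\<lambda>z. \<Sum>\<alpha>\<in>A. p \<alpha> * Defs.monom \<alpha> (($) z)) | A p. finite A}"

text \<open>The image of the rational function field C(z). A zero denominator is harmless: the
  quotient is then 0.\<close>

definition rat_cls :: "(complex^'n) generic set" where
  "rat_cls = {a / b | a b. a \<in> poly_cls \<and> b \<in> poly_cls}"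

lemma monom_cls: "cls (\<lambda>z. c * Defs.monom \<alpha> (($) z)) \<in> poly_cls"
  unfolding poly_cls_def by (intro CollectI exI[of _ "{\<alpha>}"] exI[of _ "\<lambda>_. c"]) simp

lemma const_cls: "cls (\<lambda>_. c) \<in> poly_cls"
  using monom_cls[of c "\<lambda>_. 0"] by (simp add: monom_def)

lemma poly_cls_add:
  assumes "a \<in> poly_cls" "b \<in> poly_cls"
  shows "a + b \<in> poly_cls"
proof -
  obtain A p B q where A: "finite A" "a = cls (\<lambda>z. \<Sum>\<alpha>\<in>A. p \<alpha> * Defs.monom \<alpha> (($) z))"
    and B: "finite B" "b = cls (\<lambda>z. \<Sum>\<alpha>\<in>B. q \<alpha> * Defs.monom \<alpha> (($) z))"
    using assms unfolding poly_cls_def by blast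
  define p' where "p' \<alpha> = (if \<alpha> \<in> A then p \<alpha> else 0)" for \<alpha>
  define q' where "q' \<alpha> = (if \<alpha> \<in> B then q \<alpha> else 0)" for \<alpha>
  have "(\<Sum>\<alpha>\<in>A. p \<alpha> * Defs.monom \<alpha> x) = (\<Sum>\<alpha>\<in>A \<union> B. p' \<alpha> * Defs.monom \<alpha> x)" for x
    using A B by (intro sum.mono_neutral_cong_left) (auto simp: p'_def)
  moreover have "(\<Sum>\<alpha>\<in>B. q \<alpha> * Defs.monom \<alpha> x) = (\<Sum>\<alpha>\<in>A \<union> B. q' \<alpha> * Defs.monom \<alpha> x)" for x
    using A B by (intro sum.mono_neutral_cong_left) (auto simp: q'_def)
  ultimately have "a + b = cls (\<lambda>z. \<Sum>\<alpha>\<in>A \<union> B. (p' \<alpha> + q' \<alpha>) * Defs.monom \<alpha> (($) z))"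
    by (simp add: A B distrib_right sum.distrib flip: cls_add)
  then show ?thesis
    using A B unfolding poly_cls_def
    by (intro CollectI exI[of _ "A \<union> B"] exI[of _ "\<lambda>\<alpha>. p' \<alpha> + q' \<alpha>"]) auto
qed

lemma poly_cls_sum: "(\<And>i. i \<in> I \<Longrightarrow> f i \<in> poly_cls) \<Longrightarrow> sum f I \<in> poly_cls"
  by (induction I rule: infinite_finite_induct)
    (auto intro: poly_cls_add const_cls[of 0, unfolded cls_zero])

lemma monom_mult: "Defs.monom \<alpha> x * Defs.monom \<beta> x = Defs.monom (\<lambda>i. \<alpha> i + \<beta> i) x"
  by (simp add: monom_def power_add prod.distrib)

lemma poly_cls_mult:
  assumes "a \<in> poly_cls" "b \<in> poly_cls"
  shows "a * b \<in> poly_cls"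
proof -
  obtain A p B q where A: "a = cls (\<lambda>z. \<Sum>\<alpha>\<in>A. p \<alpha> * Defs.monom \<alpha> (($) z))"
    and B: "b = cls (\<lambda>z. \<Sum>\<beta>\<in>B. q \<beta> * Defs.monom \<beta> (($) z))"
    using assms unfolding poly_cls_def by blast
  have "a * b = cls (\<lambda>z. \<Sum>\<alpha>\<in>A. \<Sum>\<beta>\<in>B. (p \<alpha> * q \<beta>) * Defs.monom (\<lambda>i. \<alpha> i + \<beta> i) (($) z))"
    unfolding A B cls_mult[symmetric] sum_product monom_mult[symmetric] by (simp only: mult_ac)
  also have "\<dots> \<in> poly_cls"
    unfolding cls_sum by (intro poly_cls_sum monom_cls)
  finally show ?thesis .
qed

lemma subring_poly_cls: "is_subring (poly_cls :: (complex^'n) generic set)"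
proof -
  have "x - y \<in> poly_cls" if "x \<in> poly_cls" "y \<in> poly_cls" for x y :: "(complex^'n) generic"
  proof -
    have "cls (\<lambda>_. -1) = (-1 :: (complex^'n) generic)"
      using cls_add[of "\<lambda>_. 1" "\<lambda>_. -1 :: complex"]
      by (simp add: cls_zero cls_one eq_neg_iff_add_eq_0 add.commute)
    then have "(-1 :: (complex^'n) generic) \<in> poly_cls" using const_cls by metis
    then have "x + (-1) * y \<in> poly_cls"
      using that by (intro poly_cls_add poly_cls_mult)
    then show ?thesis by simp
  qed
  then show ?thesis
    unfolding is_subring_def using poly_cls_mult const_cls[of 1] by (auto simp: cls_one)
qed

lemma rat_clsI: "a \<in> poly_cls \<Longrightarrow> a \<in> rat_cls"
  unfolding rat_cls_def using subring_one[OF subring_poly_cls]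
  by (intro CollectI exI[of _ a] exI[of _ 1]) simp

lemma subfield_rat_cls: "is_subfield (rat_cls :: (complex^'n) generic set)"
proof -
  note cl = subring_closed[OF subring_poly_cls]
  have "x - y \<in> rat_cls \<and> x * y \<in> rat_cls" if xy: "x \<in> rat_cls" "y \<in> rat_cls" for x y :: "(complex^'n) generic"
  proof -
    obtain a b c d where ab: "a \<in> poly_cls" "b \<in> poly_cls" "x = a / b"
      and cd: "c \<in> poly_cls" "d \<in> poly_cls" "y = c / d"
      using xy unfolding rat_cls_def by blast
    have m: "x * y = (a * c) / (b * d)" by (simp add: ab cd)
    have "x - y = (a * d - c * b) / (b * d)" if "b \<noteq> 0" "d \<noteq> 0"
      using that by (simp add: ab cd diff_frac_eq)
    moreover have "x - y = (0 - c) / d" if "b = 0" using that by (simp add: ab cd)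
    moreover have "x - y = a / b" if "d = 0" using that by (simp add: ab cd)
    ultimately have "x - y \<in> rat_cls"
      unfolding rat_cls_def mem_Collect_eq
      using cl(3)[OF cl(4)[OF ab(1) cd(2)] cl(4)[OF cd(1) ab(2)]] cl(3)[OF cl(2) cd(1)]
        cl(4)[OF ab(2) cd(2)] ab(1,2) cd(2) by metis
    moreover have "x * y \<in> rat_cls"
      unfolding m rat_cls_def mem_Collect_eq using cl(4) ab(1,2) cd(1,2) by blast
    ultimately show ?thesis ..
  qed
  moreover have "inverse x \<in> rat_cls" if "x \<in> rat_cls" for x :: "(complex^'n) generic"
    using that unfolding rat_cls_def mem_Collect_eq by (metis inverse_divide)
  moreover have "(1 :: (complex^'n) generic) \<in> rat_cls" using rat_clsI[OF cl(1)] .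
  ultimately show ?thesis by (auto simp: is_subfield_def is_subring_def)
qed

lemma algebraic_over_rat_cls_clear_denominators:
  assumes "alg_over rat_cls x"
  shows "\<exists>p. p \<noteq> 0 \<and> (\<forall>i. coeff p i \<in> poly_cls) \<and> poly p x = 0"
proof -
  note cl = subring_closed[OF subring_poly_cls]
  obtain p where p: "p \<noteq> 0" "\<And>i. coeff p i \<in> rat_cls" "poly p x = 0"
    using assms by (auto simp: alg_over_def)
  have "\<exists>b. b \<noteq> 0 \<and> b \<in> poly_cls \<and> b * coeff p i \<in> poly_cls" for i
  proof -
    obtain a b where ab: "a \<in> poly_cls" "b \<in> poly_cls" "coeff p i = a / b"
      using p(2)[of i] unfolding rat_cls_def by blast
    show ?thesis
    proof (cases "b = 0")
      case True
      then show ?thesis using ab cl(1,2) by (intro exI[of _ 1]) auto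
    next
      case False
      then show ?thesis using ab by (intro exI[of _ b]) auto
    qed
  qed
  then obtain b where b: "\<And>i. b i \<noteq> 0" "\<And>i. b i \<in> poly_cls" "\<And>i. b i * coeff p i \<in> poly_cls"
    by metis
  define c where "c = (\<Prod>i\<le>degree p. b i)"
  have c0: "c \<noteq> 0" using b by (simp add: c_def)
  have "coeff (smult c p) i \<in> poly_cls" for i
  proof (cases "i \<le> degree p")
    case True
    then have "c = b i * (\<Prod>j\<in>{..degree p} - {i}. b j)" unfolding c_def by (intro prod.remove) auto
    then have "coeff (smult c p) i = b i * coeff p i * (\<Prod>j\<in>{..degree p} - {i}. b j)"
      by (simp add: mult_ac)
    also have "\<dots> \<in> poly_cls" by (intro cl(4)[OF b(3)] cl(9) b(2))
    finally show ?thesis .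
  next
    case False
    then show ?thesis using cl(2) by (simp add: coeff_eq_0)
  qed
  then show ?thesis using c0 p by (intro exI[of _ "smult c p"]) auto
qed

text \<open>An equation for the class of f, with denominators cleared, says that the holomorphic
  function P(z, f(z)) has class 0; so it vanishes at every point of the ball, not just
  generically.\<close>

lemma algebraic_cls_imp_algebraic_fun_on:
  fixes f :: "complex^'n \<Rightarrow> complex"
  assumes f: "holo_on (ball 0 r) f" and alg: "alg_over rat_cls (cls f)"
  shows "algebraic_fun_on ((\<lambda>z i. z $ i) ` ball 0 r) (\<lambda>x. f (\<chi> i. x i))"
proof -
  obtain p where p: "p \<noteq> 0" "\<And>j. coeff p j \<in> poly_cls" "poly p (cls f) = 0"
    using algebraic_over_rat_cls_clear_denominators[OF alg] by blast
  have "\<forall>j. \<exists>A q. finite A \<and> coeff p j = cls (\<lambda>z. \<Sum>\<alpha>\<in>A. q \<alpha> * Defs.monom \<alpha> (($) z))"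
    using p(2) unfolding poly_cls_def by blast
  then obtain A q where A: "\<And>j. finite (A j)"
    and q: "\<And>j. coeff p j = cls (\<lambda>z. \<Sum>\<alpha>\<in>A j. q j \<alpha> * Defs.monom \<alpha> (($) z))"
    unfolding choice_iff by blast
  \<comment> \<open>The sets \<open>A j\<close> are chosen for all j; the bound
    \<open>degree p\<close> makes the support of P finite.\<close>
  define P where "P = (\<lambda>(\<alpha>, j). if j \<le> degree p \<and> \<alpha> \<in> A j then q j \<alpha> else 0)"
  have fD: "finite (SIGMA j:{..degree p}. A j)" using A by auto
  define D where "D = (\<lambda>(j, \<alpha>). (\<alpha>, j)) ` (SIGMA j:{..degree p}. A j)"
  have fin: "finite D" unfolding D_def using fD by (rule finite_imageI)
  have supp: "{s. P s \<noteq> 0} \<subseteq> D" by (auto simp: P_def D_def image_iff split: if_splits)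
  have ev: "poly_eval P x w = (\<Sum>j\<le>degree p. (\<Sum>\<alpha>\<in>A j. q j \<alpha> * Defs.monom \<alpha> x) * w ^ j)" for x w
  proof -
    have "poly_eval P x w = (\<Sum>s\<in>D. P s * Defs.monom (fst s) x * w ^ snd s)"
      unfolding poly_eval_def using fin supp by (intro sum.mono_neutral_left) auto
    also have "\<dots> = (\<Sum>(j, \<alpha>)\<in>(SIGMA j:{..degree p}. A j). q j \<alpha> * Defs.monom \<alpha> x * w ^ j)"
      unfolding D_def by (subst sum.reindex) (auto simp: inj_on_def P_def intro!: sum.cong)
    also have "\<dots> = (\<Sum>j\<le>degree p. \<Sum>\<alpha>\<in>A j. q j \<alpha> * Defs.monom \<alpha> x * w ^ j)"
      using A by (intro sum.Sigma[symmetric]) auto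
    finally show ?thesis by (simp add: sum_distrib_right)
  qed
  define g where "g z = poly_eval P (($) z) (f z)" for z
  have hg: "holo_on (ball 0 r) g"
    unfolding g_def ev
    by (intro holo_on_sum holo_on_mult holo_on_power holo_on_const holo_on_monom f)
  have "cls g = poly p (cls f)"
    unfolding g_def ev poly_altdef q by (simp only: cls_sum cls_mult cls_power)
  then have "cls g = 0" using p by simp
  then have g0: "g z = 0" if "z \<in> ball 0 r" for z using cls_holo_nonzero[OF hg that] by blast
  have "P \<noteq> (\<lambda>_. 0)"
  proof
    assume P: "P = (\<lambda>_. 0)"
    have "coeff p j = 0" if "j \<le> degree p" for j
    proof -
      have "q j \<alpha> = 0" if "\<alpha> \<in> A j" for \<alpha>
        using fun_cong[OF P, of "(\<alpha>, j)"] that \<open>j \<le> degree p\<close> by (simp add: P_def)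
      then show ?thesis unfolding q by (simp add: cls_zero)
    qed
    then show False using p(1) by (metis leading_coeff_0_iff order_refl)
  qed
  moreover have "is_poly P" unfolding is_poly_def using finite_subset[OF supp fin] .
  moreover have "poly_eval P x (f (\<chi> i. x i)) = 0" if "x \<in> (\<lambda>z i. z $ i) ` ball 0 r" for x
    using that g0 by (auto simp: g_def)
  ultimately show ?thesis unfolding algebraic_fun_on_def by blast
qed

section \<open>Recovering the components\<close>

text \<open>Orthogonal projection of x onto A with respect to the first N coordinates. The vectors
  of A vanishing at the last coordinate form a subspace of codimension at most 1, which the
  induction handles; a single Gram-Schmidt vector e accounts for the rest.\<close>

lemma ex_hermitian_projection:
  fixes A :: "(nat \<Rightarrow> complex) set"
  assumes "(\<lambda>_. 0) \<in> A" "\<And>a b. a \<in> A \<Longrightarrow> b \<in> A \<Longrightarrow> (\<lambda>i. a i + b i) \<in> A"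
    "\<And>c a. a \<in> A \<Longrightarrow> (\<lambda>i. c * a i) \<in> A"
  shows "\<exists>a\<in>A. \<forall>a'\<in>A. (\<Sum>i<N. (x i - a i) * cnj (a' i)) = 0"
  using assms
proof (induction N arbitrary: A x)
  case 0
  then show ?case by auto
next
  case (Suc N)
  define A' where "A' = {a \<in> A. a N = 0}"
  have A': "(\<lambda>_. 0) \<in> A'" "\<And>a b. a \<in> A' \<Longrightarrow> b \<in> A' \<Longrightarrow> (\<lambda>i. a i + b i) \<in> A'"
    "\<And>c a. a \<in> A' \<Longrightarrow> (\<lambda>i. c * a i) \<in> A'"
    using Suc.prems by (auto simp: A'_def)
  \<comment> \<open>The summand at N vanishes because a' N = 0, so orthogonality in the first N
    coordinates is enough.\<close>
  have proj: "\<exists>a\<in>A'. \<forall>a'\<in>A'. (\<Sum>i<Suc N. (x i - a i) * cnj (a' i)) = 0" for x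
    using Suc.IH[OF A', of x] by (auto simp: A'_def)
  show ?case
  proof (cases "A' = A")
    case True
    then show ?thesis using proj by simp
  next
    case False
    then obtain s where s: "s \<in> A" "s N \<noteq> 0" by (auto simp: A'_def)
    obtain p where p: "p \<in> A'" "\<And>a'. a' \<in> A' \<Longrightarrow> (\<Sum>i<Suc N. (s i - p i) * cnj (a' i)) = 0"
      using proj[of s] by blast
    define e where "e i = s i + (-1) * p i" for i
    have "p \<in> A" using p(1) by (simp add: A'_def)
    then have eA: "e \<in> A" unfolding e_def by (intro Suc.prems(2,3) s(1))
    have eN: "e N \<noteq> 0" using s p by (auto simp: e_def A'_def)
    define ip where "ip a b = (\<Sum>i<Suc N. a i * cnj (b i))" for a b :: "nat \<Rightarrow> complex"
    have e_orth: "ip e a' = 0" if "a' \<in> A'" for a' using p(2)[OF that] by (simp add: ip_def e_def)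
    have ee: "ip e e \<noteq> 0"
    proof -
      have "ip e e = of_real (\<Sum>i<Suc N. (norm (e i))\<^sup>2)"
        unfolding ip_def of_real_sum complex_norm_square by (rule refl)
      moreover have "(\<Sum>i<Suc N. (norm (e i))\<^sup>2) \<noteq> 0"
        using eN by (subst sum_nonneg_eq_0_iff) auto
      ultimately show ?thesis by (simp only: of_real_eq_0_iff not_False_eq_True)
    qed
    obtain b where b: "b \<in> A'" "\<And>a'. a' \<in> A' \<Longrightarrow> ip (\<lambda>i. x i - b i) a' = 0"
      using proj[of x] unfolding ip_def by blast
    define c where "c = ip (\<lambda>i. x i - b i) e / ip e e"
    define y where "y i = b i + c * e i" for i
    have "b \<in> A" using b(1) by (simp add: A'_def)
    then have yA: "y \<in> A" unfolding y_def by (intro Suc.prems(2,3) eA)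
    have lin: "ip (\<lambda>i. x i - y i) a = ip (\<lambda>i. x i - b i) a - c * ip e a" for a
      by (simp add: ip_def y_def sum_distrib_left sum_subtractf[symmetric] algebra_simps
          del: sum.lessThan_Suc)
    have "ip (\<lambda>i. x i - y i) a = 0" if a: "a \<in> A" for a
    proof -
      \<comment> \<open>Subtracting d e from a cancels coordinate N, so a splits into an element of
        \<open>A'\<close> and a multiple of e; x - y is orthogonal to both.\<close>
      define d where "d = a N / e N"
      define a' where "a' i = a i + (- d) * e i" for i
      have "a' \<in> A" unfolding a'_def by (intro Suc.prems(2,3) a eA)
      then have a'A: "a' \<in> A'" using eN by (simp add: A'_def a'_def d_def)
      have "a = (\<lambda>i. a' i + d * e i)" by (simp add: a'_def)
      then have "ip z a = ip z a' + cnj d * ip z e" for z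
        by (simp add: ip_def sum_distrib_left sum.distrib algebra_simps del: sum.lessThan_Suc)
      then show ?thesis
        unfolding lin using b(2)[OF a'A] e_orth[OF a'A] ee by (simp add: c_def)
    qed
    then show ?thesis using yA unfolding ip_def by blast
  qed
qed

section \<open>Algebraicity of the restriction of phi to curves\<close>

definition alg_cls :: "(complex^'n) generic set" where
  "alg_cls = {x. alg_over rat_cls x}"

lemma subfield_alg_cls: "is_subfield (alg_cls :: (complex^'n) generic set)"
  unfolding alg_cls_def by (rule subfield_algebraic_closure[OF subfield_rat_cls])

lemma subring_alg_cls: "is_subring (alg_cls :: (complex^'n) generic set)"
  by (rule subfield_alg_cls[unfolded is_subfield_def, THEN conjunct1])

lemma alg_over_alg_cls: "alg_over alg_cls x \<Longrightarrow> x \<in> alg_cls"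
  unfolding alg_cls_def using alg_over_algebraic_closure[OF subfield_rat_cls] by blast

lemma poly_cls_subset_alg_cls: "poly_cls \<subseteq> alg_cls"
proof
  fix a :: "(complex^'n) generic" assume a: "a \<in> poly_cls"
  note cl = subring_closed[OF subring_poly_cls]
  have "coeff [:- a, 1:] i \<in> rat_cls" for i
    using rat_clsI[OF cl(5)[OF a]] rat_clsI[OF cl(1)] rat_clsI[OF cl(2)]
    by (auto simp: coeff_pCons split: nat.split)
  then show "a \<in> alg_cls"
    unfolding alg_cls_def alg_over_def by (intro CollectI exI[of _ "[:- a, 1:]"]) auto
qed

lemma monom_case_sum:
  "Defs.monom \<sigma> (case_sum x y) = Defs.monom (\<lambda>i. \<sigma> (Inl i)) x * Defs.monom (\<lambda>i. \<sigma> (Inr i)) y"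
  unfolding monom_def UNIV_Plus_UNIV[symmetric] by (subst prod.Plus) auto

text \<open>The exponents \<open>e\<close> depend on the polynomial of \<open>\<phi>\<close>: they keep it nonzero after
  substituting any such curve.\<close>

lemma algebraic2_on_curve_coeffs:
  fixes \<phi> :: "(complex^'n) \<times> (complex^'n) \<Rightarrow> complex"
  assumes alg: "algebraic2_on (ball 0 r \<times> ball 0 r) \<phi>" and r: "r > 0"
  shows "\<exists>e. (\<forall>i. 0 < e i) \<and> (\<forall>\<eta>\<in>ball 0 r. (\<forall>i. \<eta> $ i \<noteq> 0) \<longrightarrow>
    (\<forall>W. (\<forall>z\<in>ball 0 r. (\<lambda>t. \<phi> (z, kcurve e \<eta> t)) has_fps_expansion W z) \<longrightarrow>
      (\<forall>n. fps_nth (cls_fps W) n \<in> alg_cls)))"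
proof -
  obtain P where P: "is_poly P" "P \<noteq> (\<lambda>_. 0)"
    and P0: "\<And>z \<xi>. z \<in> ball 0 r \<Longrightarrow> \<xi> \<in> ball 0 r \<Longrightarrow>
      poly_eval P (case_sum (($) z) (($) \<xi>)) (\<phi> (z, \<xi>)) = 0"
  proof -
    from alg obtain P where "is_poly P" "P \<noteq> (\<lambda>_. 0)"
      and *: "\<forall>x\<in>(\<lambda>(z,\<xi>). case_sum (\<lambda>i. z $ i) (\<lambda>i. \<xi> $ i)) ` (ball 0 r \<times> ball 0 r).
        poly_eval P x (\<phi> (\<chi> i. x (Inl i), \<chi> i. x (Inr i))) = 0"
      unfolding algebraic2_on_def algebraic_fun_on_def by blast
    moreover have "poly_eval P (case_sum (($) z) (($) \<xi>)) (\<phi> (z, \<xi>)) = 0"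
      if "z \<in> ball 0 r" "\<xi> \<in> ball 0 r" for z \<xi>
      using bspec[OF *, of "case_sum (($) z) (($) \<xi>)"] that by force
    ultimately show ?thesis using that by blast
  qed
  define S where "S = {s. P s \<noteq> 0}"
  have fS: "finite S" using P(1) by (simp add: S_def is_poly_def)
  define zp where "zp s = (\<lambda>i. fst s (Inl i))" for s :: "('n + 'n \<Rightarrow> nat) \<times> nat"
  define xp where "xp s = (\<lambda>i. fst s (Inr i))" for s :: "('n + 'n \<Rightarrow> nat) \<times> nat"
  \<comment> \<open>Only the \<xi>-exponents occurring in P have to be separated; z is not
    restricted to a curve.\<close>
  obtain e where e: "\<And>i. 0 < e i" "inj_on (\<lambda>\<alpha>. \<Sum>i\<in>UNIV. e i * \<alpha> i) (xp ` S)"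
    using ex_separating_weights[of "xp ` S"] fS by blast
  define wt where "wt \<alpha> = (\<Sum>i\<in>UNIV. e i * \<alpha> i)" for \<alpha>
  have "fps_nth (cls_fps W) n \<in> alg_cls"
    if \<eta>: "\<eta> \<in> ball 0 r" "\<And>i. \<eta> $ i \<noteq> 0"
      and W: "\<And>z. z \<in> ball 0 r \<Longrightarrow> (\<lambda>t. \<phi> (z, kcurve e \<eta> t)) has_fps_expansion W z" for \<eta> W n
  proof -
    define a where "a s z = P s * Defs.monom (xp s) (($) \<eta>) * Defs.monom (zp s) (($) z)" for s z
    \<comment> \<open>P after the substitution of the curve for \<xi>: a polynomial in the value of
      \<phi>, whose coefficients are polynomials in t over \<open>poly_cls\<close>.\<close>
    define Q where "Q = (\<Sum>s\<in>S. Polynomial.monom (fps_const (cls (a s)) * fps_X ^ wt (xp s)) (snd s))"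
    have "poly Q (cls_fps W) = cls_fps (\<lambda>z. \<Sum>s\<in>S. fps_const (a s z) * fps_X ^ wt (xp s) * W z ^ snd s)"
      unfolding Q_def poly_sum poly_monom
      by (simp only: cls_fps_sum cls_fps_mult cls_fps_const cls_fps_power cls_fps_X)
    also have "\<dots> = cls_fps (\<lambda>_. 0)"
    proof (rule cls_fps_eqI)
      fix z :: "complex^'n" assume z: "z \<in> ball 0 r"
      have "(\<lambda>t. \<Sum>s\<in>S. a s z * t ^ wt (xp s) * \<phi> (z, kcurve e \<eta> t) ^ snd s) has_fps_expansion
          (\<Sum>s\<in>S. fps_const (a s z) * fps_X ^ wt (xp s) * W z ^ snd s)"
        by (intro fps_expansion_intros W z)
      moreover have "eventually (\<lambda>t. t \<in> {t. kcurve e \<eta> t \<in> ball 0 r}) (nhds 0)"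
        by (intro eventually_nhds_in_open kcurve_domain(1,3) e \<eta>)
      then have "eventually (\<lambda>t. (\<Sum>s\<in>S. a s z * t ^ wt (xp s) * \<phi> (z, kcurve e \<eta> t) ^ snd s) = 0) (nhds 0)"
      proof eventually_elim
        case (elim t)
        have "a s z * t ^ wt (xp s) = P s * Defs.monom (fst s) (case_sum (($) z) (($) (kcurve e \<eta> t)))" for s
          unfolding monom_case_sum a_def zp_def xp_def monom_kcurve wt_def by (simp only: mult_ac)
        then show ?case
          using P0[OF z, of "kcurve e \<eta> t"] elim by (simp add: poly_eval_def S_def)
      qed
      ultimately have "(\<lambda>_. 0) has_fps_expansion (\<Sum>s\<in>S. fps_const (a s z) * fps_X ^ wt (xp s) * W z ^ snd s)"
        using has_fps_expansion_cong[OF _ refl] by fast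
      then show "(\<Sum>s\<in>S. fps_const (a s z) * fps_X ^ wt (xp s) * W z ^ snd s) = 0"
        using fps_expansion_unique_complex[OF _ has_fps_expansion_0] by blast
    qed (use r in auto)
    finally have root: "poly Q (cls_fps W) = 0" by (simp add: cls_fps_zero)
    have coeffQ: "fps_nth (coeff Q j) k = (\<Sum>s\<in>S. if snd s = j \<and> wt (xp s) = k then cls (a s) else 0)" for j k
      unfolding Q_def coeff_sum fps_sum_nth coeff_monom
      by (intro sum.cong refl) (auto simp: fps_X_power_nth)
    have ca: "cls (a s) \<in> alg_cls" for s
    proof -
      have "cls (\<lambda>z. a s z) \<in> poly_cls" unfolding a_def by (rule monom_cls)
      then show ?thesis using poly_cls_subset_alg_cls by blast
    qed
    have cQ: "fps_nth (coeff Q j) k \<in> alg_cls" for j k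
      unfolding coeffQ using ca subring_zero[OF subring_alg_cls]
      by (intro subring_sum[OF subring_alg_cls]) auto
    have "Q \<noteq> 0"
    proof
      assume "Q = 0"
      obtain s0 where s0: "s0 \<in> S" using P(2) unfolding S_def by fastforce
      \<comment> \<open>Fix a term s0 of P and look at Q in its degree in the value of \<phi> and in
        its t-degree. By separation of weights, exactly the terms with the \<xi>-exponent of s0 meet
        there. They differ in their z-exponents, so they form a polynomial in z that cannot cancel.
        The function \<open>sof\<close> recovers a term of S' from its z-exponent.\<close>
      define S' where "S' = {s \<in> S. snd s = snd s0 \<and> xp s = xp s0}"
      define sof where "sof \<alpha> = (case_sum \<alpha> (xp s0), snd s0)" for \<alpha> :: "'n \<Rightarrow> nat"
      define p where "p \<alpha> = P (sof \<alpha>) * Defs.monom (xp s0) (($) \<eta>)" for \<alpha>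
      have fS': "finite S'" "s0 \<in> S'" using fS s0 by (auto simp: S'_def)
      have sof: "sof (zp s) = s" if "s \<in> S'" for s
      proof -
        have "case_sum (zp s) (xp s) = fst s"
          by (rule ext) (simp add: zp_def xp_def split: sum.split)
        then show ?thesis using that by (simp add: sof_def S'_def prod_eq_iff)
      qed
      have inj: "inj_on zp S'" by (rule inj_on_inverseI[of _ sof]) (rule sof)
      have "0 = fps_nth (coeff Q (snd s0)) (wt (xp s0))" using \<open>Q = 0\<close> by simp
      also have "\<dots> = (\<Sum>s\<in>S. if s \<in> S' then cls (a s) else 0)"
        unfolding coeffQ using e(2) s0
        by (intro sum.cong) (auto simp: S'_def wt_def inj_on_def)
      also have "\<dots> = (\<Sum>s\<in>S'. cls (a s))"
        using fS by (subst sum.inter_restrict[symmetric]) (auto simp: S'_def Int_def intro!: sum.cong)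
      also have "\<dots> = cls (\<lambda>z. \<Sum>s\<in>S'. a s z)" by (simp add: cls_sum)
      also have "(\<lambda>z. \<Sum>s\<in>S'. a s z) = (\<lambda>z. \<Sum>\<alpha>\<in>zp ` S'. p \<alpha> * Defs.monom \<alpha> (($) z))"
      proof (rule ext)
        fix z
        have "a s z = p (zp s) * Defs.monom (zp s) (($) z)" if "s \<in> S'" for s
          using sof[OF that] that by (simp add: a_def p_def) (simp add: S'_def)
        then show "(\<Sum>s\<in>S'. a s z) = (\<Sum>\<alpha>\<in>zp ` S'. p \<alpha> * Defs.monom \<alpha> (($) z))"
          by (simp add: sum.reindex[OF inj])
      qed
      finally have c0: "cls (\<lambda>z. \<Sum>\<alpha>\<in>zp ` S'. p \<alpha> * Defs.monom \<alpha> (($) z)) = 0" by simp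
      have "holo_on (ball 0 r) (\<lambda>z. \<Sum>\<alpha>\<in>zp ` S'. p \<alpha> * Defs.monom \<alpha> (($) z))"
        by (intro holo_on_sum holo_on_mult holo_on_const holo_on_monom)
      from cls_holo_nonzero[OF this] c0
      have "(\<Sum>\<alpha>\<in>zp ` S'. p \<alpha> * Defs.monom \<alpha> (($) z)) = 0" if "z \<in> ball 0 r" for z
        using that by blast
      then have "p (zp s0) = 0"
        using fS' r by (intro monom_independent[of "zp ` S'" r p]) auto
      moreover have "P s0 \<noteq> 0" using s0 by (simp add: S_def)
      ultimately show False using \<eta>(2) fS' by (auto simp: p_def sof monom_def)
    qed
    then show ?thesis
      by (intro fps_root_nth[OF subring_alg_cls alg_over_alg_cls _ cQ root])
  qed
  then show ?thesis using e(1) by (intro exI[of _ e]) blast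
qed

section \<open>Conjugate maps along curves, and the assembly of the argument\<close>

lemma vconj_kcurve: "vconj (kcurve e \<eta> t) = kcurve e (vconj \<eta>) (cnj t)"
  by (simp add: vconj_def kcurve_def vec_eq_iff)

lemma norm_vconj [simp]: "norm (vconj \<eta>) = norm \<eta>"
  by (simp add: vconj_def norm_vec_def)

lemma vconj_vconj [simp]: "vconj (vconj \<eta>) = \<eta>"
  by (simp add: vconj_def vec_eq_iff)

text \<open>The conjugate of the curve to \<eta> is the curve to \<open>vconj \<eta>\<close> at the
  conjugate parameter, so the function is t \<mapsto> cnj (h (cnj t)) with h holomorphic.\<close>

lemma bar_map_kcurve_holomorphic:
  fixes H :: "complex^'n \<Rightarrow> nat \<Rightarrow> complex"
  assumes H: "holo_map_on (ball 0 r) N H" and k: "k < N"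
    and e: "\<And>i. 0 < e i" and \<eta>: "\<eta> \<in> ball 0 r"
  shows "(\<lambda>t. bar_map H (kcurve e \<eta> t) k) holomorphic_on {t. kcurve e \<eta> t \<in> ball 0 r}"
proof -
  let ?T = "{t. kcurve e \<eta> t \<in> ball 0 r}" and ?T' = "{t. kcurve e (vconj \<eta>) t \<in> ball 0 r}"
  have h: "holo_on (ball 0 r) (\<lambda>z. H z k)" using H k by (simp add: holo_map_on_def)
  have oT: "open ?T" by (rule kcurve_domain(1)[OF e \<eta>])
  have oT': "open ?T'" by (rule kcurve_domain(1)[OF e]) (use \<eta> in simp)
  have "(\<lambda>t. H (kcurve e (vconj \<eta>) t) k) holomorphic_on ?T'"
    by (rule holo_on_compose_curve[OF h oT'])
      (auto simp: kcurve_def intro!: field_differentiable_mult field_differentiable_power)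
  moreover have "cnj ` ?T \<subseteq> ?T'"
  proof
    fix s assume "s \<in> cnj ` ?T"
    then obtain t where "s = cnj t" "kcurve e \<eta> t \<in> ball 0 r" by auto
    then show "s \<in> ?T'" by (simp flip: vconj_kcurve)
  qed
  ultimately have "(\<lambda>t. H (kcurve e (vconj \<eta>) t) k) holomorphic_on cnj ` ?T"
    by (rule holomorphic_on_subset)
  from holomorphic_on_compose_cnj_cnj[OF this oT] show ?thesis
    by (simp add: o_def bar_map_def vconj_kcurve)
qed

text \<open>The product of all coordinates has nonzero class, and multiplying f by it gives 0
  everywhere on the ball. This makes up for curves being available only for \<eta> off the
  coordinate hyperplanes.\<close>

lemma cls_zero_offaxes:
  fixes f :: "complex^'n \<Rightarrow> complex"
  assumes r: "r > 0" and f: "\<And>z. z \<in> ball 0 r \<Longrightarrow> (\<And>i. z $ i \<noteq> 0) \<Longrightarrow> f z = 0"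
  shows "cls f = 0"
proof -
  define p where "p z = Defs.monom (\<lambda>_. 1) (($) z)" for z :: "complex^'n"
  have "cls (\<lambda>z. p z * f z) = cls (\<lambda>_. 0)"
  proof (rule cls_eqI)
    show "p z * f z = 0" if "z \<in> ball 0 r" for z
      using f[OF that] by (auto simp: p_def monom_def)
  qed (use r in auto)
  then have "cls p * cls f = 0" by (simp add: cls_mult cls_zero)
  moreover have "cls p \<noteq> 0"
  proof
    assume "cls p = 0"
    moreover have "holo_on (ball 0 r) (\<lambda>z. p z)" unfolding p_def by (rule holo_on_monom)
    ultimately have "p z = 0" if "z \<in> ball 0 r" for z
      using cls_holo_nonzero[of r p z] that by blast
    then have "(\<Sum>\<alpha>\<in>{\<lambda>_. 1}. 1 * Defs.monom \<alpha> (($) z)) = 0" if "z \<in> ball 0 r" for z :: "complex^'n"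
      using that by (simp add: p_def)
    from monom_independent[OF _ r this, of "\<lambda>_. 1"] show False by simp
  qed
  ultimately show ?thesis by simp
qed

text \<open>The constant vectors whose pairing with H is algebraic form a subspace A, which contains
  the Taylor vectors of the curves. A vector orthogonal to A pairs with H to the class 0, which is
  algebraic, so it belongs to A too. Projection onto A then shows that A contains every vector, in
  particular the unit vectors.\<close>

lemma nash_algebraic_if_curve_coeffs_algebraic:
  fixes H :: "complex^'n \<Rightarrow> nat \<Rightarrow> complex"
  assumes r: "r > 0" and H: "holo_map_on (ball 0 r) N H" and e: "\<And>i. 0 < e i"
    and C: "\<And>\<eta> k. \<eta> \<in> ball 0 r \<Longrightarrow> k < N \<Longrightarrow>
      (\<lambda>t. bar_map H (kcurve e \<eta> t) k) has_fps_expansion C \<eta> k"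
    and alg: "\<And>\<eta> n. \<eta> \<in> ball 0 r \<Longrightarrow> (\<And>i. \<eta> $ i \<noteq> 0) \<Longrightarrow>
      (\<Sum>k<N. cls (\<lambda>_. fps_nth (C \<eta> k) n) * cls (\<lambda>z. H z k)) \<in> alg_cls"
  shows "nash_algebraic_on (ball 0 r) N H"
proof -
  note ring = subring_closed[OF subring_alg_cls]
  define A where "A = {a. (\<Sum>k<N. cls (\<lambda>_. a k) * cls (\<lambda>z. H z k)) \<in> alg_cls}"
  have A: "(\<lambda>_. 0) \<in> A" "\<And>a b. a \<in> A \<Longrightarrow> b \<in> A \<Longrightarrow> (\<lambda>i. a i + b i) \<in> A"
    "\<And>c a. a \<in> A \<Longrightarrow> (\<lambda>i. c * a i) \<in> A"
  proof -
    show "(\<lambda>_. 0) \<in> A" by (simp add: A_def cls_zero ring)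
    show "(\<lambda>i. a i + b i) \<in> A" if "a \<in> A" "b \<in> A" for a b
      using that ring(6) by (simp add: A_def cls_add distrib_right sum.distrib)
    show "(\<lambda>i. c * a i) \<in> A" if a: "a \<in> A" for a c
    proof -
      have "cls (\<lambda>_. c) \<in> alg_cls" using const_cls poly_cls_subset_alg_cls by blast
      then have "cls (\<lambda>_. c) * (\<Sum>k<N. cls (\<lambda>_. a k) * cls (\<lambda>z. H z k)) \<in> alg_cls"
        using ring(4) a by (simp add: A_def)
      then show ?thesis by (simp add: A_def cls_mult sum_distrib_left mult.assoc)
    qed
  qed
  have orth: "b \<in> A" if b: "\<And>a. a \<in> A \<Longrightarrow> (\<Sum>k<N. b k * cnj (a k)) = 0" for b
  proof -
    have "(\<Sum>k<N. b k * H \<zeta> k) = 0" if \<zeta>: "\<zeta> \<in> ball 0 r" "\<And>i. \<zeta> $ i \<noteq> 0" for \<zeta>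
    proof -
      \<comment> \<open>Chosen so that at t = 1 the conjugate map takes the conjugate of the value H
        \<zeta>.\<close>
      define \<eta> where "\<eta> = vconj \<zeta>"
      have \<eta>: "\<eta> \<in> ball 0 r" "\<And>i. \<eta> $ i \<noteq> 0" using \<zeta> by (auto simp: \<eta>_def vconj_def[of \<zeta>] norm_vconj[of \<zeta>, unfolded vconj_def])
      let ?T = "{t. kcurve e \<eta> t \<in> ball 0 r}"
      define g where "g t = (\<Sum>k<N. cnj (b k) * bar_map H (kcurve e \<eta> t) k)" for t
      have hg: "g holomorphic_on ?T"
        unfolding g_def by (intro holomorphic_intros bar_map_kcurve_holomorphic[OF H _ e \<eta>(1)]) auto
      have "g has_fps_expansion (\<Sum>k<N. fps_const (cnj (b k)) * C \<eta> k)"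
        unfolding g_def by (intro fps_expansion_intros C \<eta>) auto
      moreover have "(\<Sum>k<N. fps_const (cnj (b k)) * C \<eta> k) = 0"
      proof (rule fps_ext)
        fix n
        have "(\<lambda>k. fps_nth (C \<eta> k) n) \<in> A" using alg[OF \<eta>] by (simp add: A_def)
        from arg_cong[OF b[OF this], of cnj]
        show "fps_nth (\<Sum>k<N. fps_const (cnj (b k)) * C \<eta> k) n = fps_nth 0 n"
          by (simp add: fps_sum_nth)
      qed
      ultimately have "eventually (\<lambda>t. g t = 0) (nhds 0)"
        by (simp add: has_fps_expansion_0_iff)
      then obtain U where U: "open U" "0 \<in> U" "\<And>t. t \<in> U \<Longrightarrow> g t = 0"
        by (auto simp: eventually_nhds)
      have dom: "open ?T" "connected ?T" "0 \<in> ?T" "1 \<in> ?T" "kcurve e \<eta> 1 = \<eta>"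
        using kcurve_domain[where e = e, OF e \<eta>(1)] by auto
      have "g 1 = 0"
      proof (rule analytic_continuation[OF hg dom(1,2), of "U \<inter> ?T" 0])
        show "0 islimpt U \<inter> ?T"
          using U dom by (simp add: interior_limit_point interior_open open_Int)
      qed (use U dom in auto)
      moreover have "vconj \<eta> = \<zeta>" by (simp add: \<eta>_def)
      ultimately have "cnj (\<Sum>k<N. b k * H \<zeta> k) = 0"
        by (simp add: g_def dom(5) bar_map_def)
      then show ?thesis by (simp only: complex_cnj_zero_iff)
    qed
    then have "cls (\<lambda>z. \<Sum>k<N. b k * H z k) = 0" by (rule cls_zero_offaxes[OF r])
    then show ?thesis using ring(2) by (simp add: A_def cls_sum cls_mult)
  qed
  have total: "x \<in> A" for x
  proof -
    obtain a where a: "a \<in> A" "\<And>a'. a' \<in> A \<Longrightarrow> (\<Sum>i<N. (x i - a i) * cnj (a' i)) = 0"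
      using ex_hermitian_projection[of A x N] A by blast
    have "(\<lambda>i. x i - a i) \<in> A" using orth a(2) by simp
    from A(2)[OF this a(1)] show ?thesis by simp
  qed
  have "cls (\<lambda>z. H z k) \<in> alg_cls" if k: "k < N" for k
  proof -
    have "(\<Sum>j<N. cls (\<lambda>_. if j = k then 1 else 0) * cls (\<lambda>z. H z j)) \<in> alg_cls"
      using total[of "\<lambda>j. if j = k then 1 else 0"] by (simp add: A_def)
    also have "(\<Sum>j<N. cls (\<lambda>_. if j = k then 1 else 0) * cls (\<lambda>z. H z j))
      = (\<Sum>j<N. if j = k then cls (\<lambda>z. H z j) else 0)"
      by (intro sum.cong) (auto simp: cls_one cls_zero)
    finally show ?thesis using k by simp
  qed
  then show ?thesis
    using H algebraic_cls_imp_algebraic_fun_on[where f = "\<lambda>z. H z _"]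
    unfolding nash_algebraic_on_def holo_map_on_def alg_cls_def by blast
qed

text \<open>Treats F_l and G_j as one family with exponents of either sign; the condition on the
  spans enters as \<open>indep\<close>. The coefficients are tested in each valuation ring over
  \<open>rat_cls\<close>, where all factors are reduced simultaneously.\<close>

lemma nash_algebraic_factors:
  fixes H :: "'i \<Rightarrow> complex^'n \<Rightarrow> nat \<Rightarrow> complex" and c :: "'i \<Rightarrow> complex"
  assumes I: "finite I" and r: "r > 0"
    and H: "\<And>i. i \<in> I \<Longrightarrow> holo_map_on (ball 0 r) (N i) (H i)"
    and H0: "\<And>i k. i \<in> I \<Longrightarrow> k < N i \<Longrightarrow> H i 0 k = 0"
    and indep: "\<And>d. (\<Sum>i\<in>I. c i * of_nat (d i)) = 0 \<Longrightarrow> \<forall>i\<in>I. d i = 0"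
    and alg: "algebraic2_on (ball 0 r \<times> ball 0 r) \<phi>"
    and eq: "\<And>z \<xi>. z \<in> ball 0 r \<Longrightarrow> \<xi> \<in> ball 0 r \<Longrightarrow>
      (\<Prod>i\<in>I. (1 + cdot (N i) (H i z) (bar_map (H i) \<xi>)) powr c i) = \<phi> (z, \<xi>)"
    and i0: "i0 \<in> I"
  shows "nash_algebraic_on (ball 0 r) (N i0) (H i0)"
proof -
  obtain e where e: "\<And>i. 0 < e i"
    and ealg: "\<And>\<eta> W n. \<eta> \<in> ball 0 r \<Longrightarrow> (\<And>i. \<eta> $ i \<noteq> 0) \<Longrightarrow>
      (\<And>z. z \<in> ball 0 r \<Longrightarrow> (\<lambda>t. \<phi> (z, kcurve e \<eta> t)) has_fps_expansion W z) \<Longrightarrow>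
      fps_nth (cls_fps W) n \<in> alg_cls"
    using algebraic2_on_curve_coeffs[OF alg r] by blast
  define C where "C i \<eta> k = fps_expansion (\<lambda>t. bar_map (H i) (kcurve e \<eta> t) k) 0" for i \<eta> k
  have C: "(\<lambda>t. bar_map (H i) (kcurve e \<eta> t) k) has_fps_expansion C i \<eta> k"
    if "i \<in> I" "k < N i" "\<eta> \<in> ball 0 r" for i k \<eta>
  proof -
    have "(\<lambda>t. bar_map (H i) (kcurve e \<eta> t) k) analytic_on {t. kcurve e \<eta> t \<in> ball 0 r}"
      using bar_map_kcurve_holomorphic[where e = e, OF H[OF that(1)] that(2) e that(3)]
        kcurve_domain(1)[where e = e, OF e that(3)] by (simp add: analytic_on_open)
    then have "(\<lambda>t. bar_map (H i) (kcurve e \<eta> t) k) analytic_on {0}"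
      by (rule analytic_on_subset) (use kcurve_domain(3)[where e = e, OF e that(3)] in simp)
    then show ?thesis unfolding C_def by (rule analytic_at_imp_has_fps_expansion_0)
  qed
  have bar0: "bar_map (H i) 0 k = 0" if "i \<in> I" "k < N i" for i k
    using H0[OF that] by (simp add: bar_map_def vconj_def zero_vec_def[symmetric])
  show ?thesis
  proof (rule nash_algebraic_if_curve_coeffs_algebraic[OF r H[OF i0] e C[OF i0]])
    fix \<eta> :: "complex^'n" and n :: nat
    assume \<eta>: "\<eta> \<in> ball 0 r" "\<And>i. \<eta> $ i \<noteq> 0"
    define U where "U i z = 1 + (\<Sum>k<N i. fps_const (H i z k) * C i \<eta> k)" for i z
    have C0: "fps_nth (C i \<eta> k) 0 = 0" if "i \<in> I" "k < N i" for i k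
      using has_fps_expansion_imp_0_eq_fps_nth_0[OF C[OF that \<eta>(1)]] bar0[OF that]
        kcurve_domain(5)[where e = e, OF e \<eta>(1)] by simp
    have U: "(\<lambda>t. 1 + cdot (N i) (H i z) (bar_map (H i) (kcurve e \<eta> t))) has_fps_expansion U i z"
      if "i \<in> I" for i z
      unfolding cdot_def U_def by (intro fps_expansion_intros C that \<eta>) auto
    \<comment> \<open>The conjugate map vanishes at 0, so at t = 0 each base equals 1 for every z.
      This gives the constant terms 1 and an analytic principal power near t = 0.\<close>
    have u0: "1 + cdot (N i) (H i z) (bar_map (H i) (kcurve e \<eta> 0)) = 1" if "i \<in> I" for i z
      using bar0[OF that] kcurve_domain(5)[where e = e, OF e \<eta>(1)] by (simp add: cdot_def)
    \<comment> \<open>W is chosen for each z separately, with no control of its dependence on z;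
      \<open>cls_fps\<close> accepts any such family, and the relation passes to classes because it
      holds for every z.\<close>
    have "\<forall>z. \<exists>W. (\<lambda>t. \<Prod>i\<in>I. (1 + cdot (N i) (H i z) (bar_map (H i) (kcurve e \<eta> t))) powr c i)
        has_fps_expansion W \<and> fps_nth W 0 = 1 \<and>
      (\<Sum>i\<in>I. fps_const (c i) * fps_deriv (U i z) * (\<Prod>j\<in>I - {i}. U j z)) * W
        = fps_deriv W * (\<Prod>i\<in>I. U i z)"
      by (rule allI) (rule log_deriv_prod_powr[OF I U u0])
    then obtain W where W: "\<And>z. (\<lambda>t. \<Prod>i\<in>I. (1 + cdot (N i) (H i z) (bar_map (H i) (kcurve e \<eta> t))) powr c i)
        has_fps_expansion W z" "\<And>z. fps_nth (W z) 0 = 1"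
      and rel: "\<And>z. (\<Sum>i\<in>I. fps_const (c i) * fps_deriv (U i z) * (\<Prod>j\<in>I - {i}. U j z)) * W z
        = fps_deriv (W z) * (\<Prod>i\<in>I. U i z)"
      unfolding choice_iff by blast
    have W\<phi>: "(\<lambda>t. \<phi> (z, kcurve e \<eta> t)) has_fps_expansion W z" if z: "z \<in> ball 0 r" for z
    proof -
      have "eventually (\<lambda>t. t \<in> {t. kcurve e \<eta> t \<in> ball 0 r}) (nhds 0)"
        by (intro eventually_nhds_in_open kcurve_domain(1,3) e \<eta>)
      then have "eventually (\<lambda>t. (\<Prod>i\<in>I. (1 + cdot (N i) (H i z) (bar_map (H i) (kcurve e \<eta> t))) powr c i)
          = \<phi> (z, kcurve e \<eta> t)) (nhds 0)"
        by eventually_elim (use eq z in auto)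
      then show ?thesis using W(1)[of z] has_fps_expansion_cong[OF _ refl] by fast
    qed
    have Walg: "fps_nth (cls_fps W) n \<in> alg_cls" for n
      using ealg[OF \<eta> W\<phi>] .
    have "cls_fps (\<lambda>z. (\<Sum>i\<in>I. fps_const (c i) * fps_deriv (U i z) * (\<Prod>j\<in>I - {i}. U j z)) * W z)
      = cls_fps (\<lambda>z. fps_deriv (W z) * (\<Prod>i\<in>I. U i z))"
      by (simp only: rel)
    then have crel: "(\<Sum>i\<in>I. fps_const (cls (\<lambda>_. c i)) * fps_deriv (cls_fps (U i))
        * (\<Prod>j\<in>I - {i}. cls_fps (U j))) * cls_fps W = fps_deriv (cls_fps W) * (\<Prod>i\<in>I. cls_fps (U i))"
      by (simp only: cls_fps_mult cls_fps_sum cls_fps_prod cls_fps_deriv cls_fps_const)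
    have Unth: "fps_nth (cls_fps (U i)) n = cls (\<lambda>_. if n = 0 then 1 else 0)
        + (\<Sum>k<N i. cls (\<lambda>_. fps_nth (C i \<eta> k) n) * cls (\<lambda>z. H i z k))" for i n
    proof -
      have "(\<lambda>z. fps_nth (U i z) n)
        = (\<lambda>z. (if n = 0 then 1 else 0) + (\<Sum>k<N i. fps_nth (C i \<eta> k) n * H i z k))"
        by (auto simp: U_def fps_sum_nth mult.commute)
      then show ?thesis by (simp only: cls_fps_nth cls_add cls_sum cls_mult)
    qed
    have U0: "fps_nth (cls_fps (U i)) 0 = 1" if "i \<in> I" for i
      unfolding Unth using C0[OF that] by (simp add: cls_one cls_zero)
    have "fps_nth (cls_fps (U i0)) n \<in> alg_cls" for n
      unfolding alg_cls_def mem_Collect_eq alg_over_iff_val_ring[OF subfield_rat_cls]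
    proof (intro allI impI)
      fix V :: "(complex^'n) generic set" assume V: "val_ring V" "rat_cls \<subseteq> V"
      have algV: "alg_cls \<subseteq> V"
        unfolding alg_cls_def using val_ring_algebraic[OF V(1) subfield_rat_cls V(2)] by blast
      have hV: "range (\<lambda>x. cls (\<lambda>_. x)) \<subseteq> V"
        using const_cls poly_cls_subset_alg_cls algV by blast
      have "\<forall>i\<in>I. \<forall>n. fps_nth (cls_fps (U i)) n \<in> V"
      proof (rule log_deriv_relation_coeffs_in[OF V(1) complex_hom_cls hV I U0 _ _ _ crel indep])
        fix i assume i: "i \<in> I"
        \<comment> \<open>The coefficients of \<open>U i\<close> lie in the complex span of the
          components of H_i and the constant function 1. The extra index k = N i carries this 1,
          which occurs only in degree n = 0.\<close>
        define y where "y k = (if k < N i then cls (\<lambda>z. H i z k) else 1)" for k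
        define a where "a n k = (if k < N i then fps_nth (C i \<eta> k) n else if n = 0 then 1 else 0)" for n k
        show "\<exists>m. fps_nth (cls_fps (U i)) m \<noteq> 0 \<and>
          (\<forall>n. fps_nth (cls_fps (U i)) n / fps_nth (cls_fps (U i)) m \<in> V)"
        proof (rule ex_dominant_in_finite_span[OF V(1) complex_hom_cls hV, of "{..N i}" _ a y])
          show "fps_nth (cls_fps (U i)) n = (\<Sum>k\<le>N i. cls (\<lambda>_. a n k) * y k)" for n
            unfolding Unth lessThan_Suc_atMost[symmetric] sum.lessThan_Suc
            by (simp add: a_def y_def add.commute)
        qed (use U0[OF i] in auto)
      next
        show "fps_nth (cls_fps W) n \<in> V" for n using Walg algV by blast
        show "fps_nth (cls_fps W) 0 = 1" using W(2) by (simp add: cls_one)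
      qed
      then show "fps_nth (cls_fps (U i0)) n \<in> V" using i0 by blast
    qed
    then have Ualg: "cls (\<lambda>_. if n = 0 then 1 else 0)
        + (\<Sum>k<N i0. cls (\<lambda>_. fps_nth (C i0 \<eta> k) n) * cls (\<lambda>z. H i0 z k)) \<in> alg_cls"
      unfolding Unth[symmetric] .
    have "cls (\<lambda>_. if n = 0 then 1 else 0) \<in> alg_cls" using const_cls poly_cls_subset_alg_cls by blast
    from subring_diff[OF subring_alg_cls Ualg this]
    show "(\<Sum>k<N i0. cls (\<lambda>_. fps_nth (C i0 \<eta> k) n) * cls (\<lambda>z. H i0 z k)) \<in> alg_cls" by simp
  qed
qed

text \<open>The span is formed over the set of values of a, so indices with equal values must be
  grouped: the coefficient of a value is the sum of d over its fibre.\<close>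

lemma weighted_sum_in_nonneg_rat_span:
  fixes a :: "nat \<Rightarrow> real"
  shows "(\<Sum>l<m. a l * of_nat (d l)) \<in> nonneg_rat_span (a ` {..<m})"
proof -
  define c :: "real \<Rightarrow> rat" where "c x = (\<Sum>l\<in>{l \<in> {..<m}. a l = x}. of_nat (d l))" for x
  have "(\<Sum>l<m. a l * of_nat (d l)) = (\<Sum>x\<in>a ` {..<m}. \<Sum>l\<in>{l \<in> {..<m}. a l = x}. a l * of_nat (d l))"
    by (rule sum.image_gen) simp
  also have "\<dots> = (\<Sum>x\<in>a ` {..<m}. of_rat (c x) * x)"
    by (intro sum.cong refl) (auto simp: c_def of_rat_sum sum_distrib_right intro!: sum.cong)
  finally show ?thesis
    unfolding nonneg_rat_span_def mem_Collect_eq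
    by (intro exI[of _ c]) (auto simp: c_def intro!: sum_nonneg)
qed

lemma sum_pos_weights_eq_0:
  fixes a :: "nat \<Rightarrow> real"
  assumes "\<forall>l<m. a l > 0" "(\<Sum>l<m. a l * of_nat (d l)) = 0"
  shows "\<forall>l<m. d l = 0"
proof -
  have "\<forall>l\<in>{..<m}. a l * of_nat (d l) = 0"
    using assms by (subst sum_nonneg_eq_0_iff[symmetric]) (auto simp: less_imp_le)
  then show ?thesis using assms(1) by force
qed

theorem theorem3p1:
  fixes lam :: "nat \<Rightarrow> real" and mu :: "nat \<Rightarrow> real" and v m :: nat
    and r :: real
    and F :: "nat \<Rightarrow> complex^'n \<Rightarrow> nat \<Rightarrow> complex" and NF :: "nat \<Rightarrow> nat"
    and G :: "nat \<Rightarrow> complex^'n \<Rightarrow> nat \<Rightarrow> complex" and NG :: "nat \<Rightarrow> nat"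
    and \<phi> :: "(complex^'n) \<times> (complex^'n) \<Rightarrow> complex"
  assumes lam_pos: "\<forall>j<v. lam j > 0"
    and mu_pos: "\<forall>l<m. mu l > 0"
    and spans: "nonneg_rat_span (lam ` {..<v}) \<inter> nonneg_rat_span (mu ` {..<m}) = {0}"
    and r_pos: "r > 0"
    and F_holo: "\<forall>l<m. holo_map_on (ball 0 r) (NF l) (F l)"
    and G_holo: "\<forall>j<v. holo_map_on (ball 0 r) (NG j) (G j)"
    and F_nonconst: "\<forall>l<m. \<exists>z\<in>ball 0 r. \<exists>i<NF l. F l z i \<noteq> F l 0 i"
    and G_nonconst: "\<forall>j<v. \<exists>z\<in>ball 0 r. \<exists>i<NG j. G j z i \<noteq> G j 0 i"
    and F_zero: "\<forall>l<m. \<forall>i<NF l. F l 0 i = 0"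
    and G_zero: "\<forall>j<v. \<forall>i<NG j. G j 0 i = 0"
    and phi_holo: "holo2_on (ball 0 r \<times> ball 0 r) \<phi>"
    and phi_alg: "algebraic2_on (ball 0 r \<times> ball 0 r) \<phi>"
    and eq: "\<forall>z\<in>ball 0 r. \<forall>\<xi>\<in>ball 0 r.
       (\<Prod>l<m. (1 + cdot (NF l) (F l z) (bar_map (F l) \<xi>)) powr complex_of_real (mu l)) *
       (\<Prod>j<v. (1 + cdot (NG j) (G j z) (bar_map (G j) \<xi>)) powr complex_of_real (- lam j))
       = \<phi> (z, \<xi>)"
  shows "(\<forall>l<m. nash_algebraic_on (ball 0 r) (NF l) (F l)) \<and>
         (\<forall>j<v. nash_algebraic_on (ball 0 r) (NG j) (G j))"
proof -
  define I :: "(nat + nat) set" where "I = {..<m} <+> {..<v}"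
  define c :: "nat + nat \<Rightarrow> complex"
    where "c = case_sum (\<lambda>l. of_real (mu l)) (\<lambda>j. of_real (- lam j))"
  have "nash_algebraic_on (ball 0 r) (case_sum NF NG i) (case_sum F G i)" if "i \<in> I" for i
  proof (rule nash_algebraic_factors[where I = I and c = c and \<phi> = \<phi>])
    fix d :: "nat + nat \<Rightarrow> nat"
    assume "(\<Sum>i\<in>I. c i * of_nat (d i)) = 0"
    also have "(\<Sum>i\<in>I. c i * of_nat (d i)) = of_real
      ((\<Sum>l<m. mu l * of_nat (d (Inl l))) - (\<Sum>j<v. lam j * of_nat (d (Inr j))))"
      unfolding I_def by (subst sum.Plus) (auto simp: c_def sum_negf)
    finally have s: "(\<Sum>l<m. mu l * of_nat (d (Inl l))) = (\<Sum>j<v. lam j * of_nat (d (Inr j)))"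
      unfolding of_real_eq_0_iff by simp
    \<comment> \<open>The common value of the two sides lies in both spans and is therefore
      0.\<close>
    then have "(\<Sum>l<m. mu l * of_nat (d (Inl l))) = 0"
      using spans weighted_sum_in_nonneg_rat_span[where a = mu and m = m and d = "\<lambda>l. d (Inl l)"]
        weighted_sum_in_nonneg_rat_span[where a = lam and m = v and d = "\<lambda>j. d (Inr j)"] by auto
    then show "\<forall>i\<in>I. d i = 0"
      using s sum_pos_weights_eq_0[OF mu_pos, of "\<lambda>l. d (Inl l)"]
        sum_pos_weights_eq_0[OF lam_pos, of "\<lambda>j. d (Inr j)"] by (auto simp: I_def)
  next
    fix z \<xi> :: "complex^'n" assume "z \<in> ball 0 r" "\<xi> \<in> ball 0 r"
    then show "(\<Prod>i\<in>I. (1 + cdot (case_sum NF NG i) (case_sum F G i z)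
        (bar_map (case_sum F G i) \<xi>)) powr c i) = \<phi> (z, \<xi>)"
      unfolding I_def using eq by (subst prod.Plus) (auto simp: c_def)
  qed (use that r_pos F_holo G_holo F_zero G_zero phi_alg in \<open>auto simp: I_def\<close>)
  from this[of "Inl _"] this[of "Inr _"] show ?thesis by (auto simp: I_def)
qed

end
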